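(* Let $\mathfrak n\in\mathsf A_+$ and $\ell\in\mathbb N$. For every character $\chi\in\widehat{\mathsf G}_{\mathfrak n,\ell}$ with (finite) conductor $\mathfrak c_\chi$, $$L_{\mathsf A}'(0,\chi)=-L_{\mathsf A}(0,\chi)\,\ln|\mathfrak c_\chi|_\infty+\sum_{\substack{a\in\mathsf A,\ \deg a<\deg\mathfrak c_\chi\\ \gcd(a,\mathfrak c_\chi)=1}}\ \sum_{i=0}^{\ell-1}\chi(a,i+\deg\mathfrak c_\chi)\cdot\ln\Big|\Gamma^*\Big(\frac{a(\theta)}{\mathfrak c_\chi(\theta)},1-\frac{q^i}{q^\ell-1}\Big)\Big|_\infty .$$ (When $\mathfrak c_\chi=1$ the outer sum has the single term $a=0$.)
   Context: $q$ is a power of a prime $p$; $A=\mathbb F_q[\theta]$, $k=\mathbb F_q(\theta)$, $k_\infty=\mathbb F_q((1/\theta))$ with $|\theta|_\infty=q$, $\mathbb C_\infty$ the completion of an algebraic closure of $k_\infty$ with extended absolute value; $A_+$ the monic elements of $A$. $\mathsf A=\mathbb F_q[t]$, $\mathsf A_+$ its monic elements; $f(\theta)$ denotes $f\in\mathsf A$ evaluated at $t=\theta$, and $|f|_\infty=|f(\theta)|_\infty$. $\mathbb N=\{1,2,\dots\}$. Characters. $\mathsf G_{\mathfrak n,\ell}$ is identified with $(\mathsf A/\mathfrak n)^\times\times\mathbb Z/\ell\mathbb Z$ (it is the Galois group over $\mathbb F_q(t)$ of the compositum of $\mathbb F_{q^\ell}$ and the $\mathfrak n$-th Carlitz cyclotomic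 function field, identified via the Artin map, a monic irreducible $\mathfrak p\nmid\mathfrak n$ having Frobenius $(\mathfrak p\bmod\mathfrak n,\deg\mathfrak p\bmod\ell)$); $\widehat{\mathsf G}_{\mathfrak n,\ell}$ is its group of complex characters. For such $\chi$, $\mathfrak c_\chi\in\mathsf A_+$ is the conductor of $\chi|_{(\mathsf A/\mathfrak n)^\times}$ and $\chi$ is regarded as a character of $(\mathsf A/\mathfrak c_\chi)^\times\times\mathbb Z/\ell\mathbb Z$. $L_{\mathsf A}(s,\chi)$ is the meromorphic continuation of $\prod_{\mathfrak p\nmid\mathfrak c_\chi}(1-\chi(\mathfrak p,\deg\mathfrak p)|\mathfrak p|_\infty^{-s})^{-1}$ ($\mathrm{Re}\,s>1$, $\mathfrak p\in\mathsf A_+$ irreducible), and $L'_{\mathsf A}$ is its derivative in $s$. Normalized gamma values. For $y=\sum_{i\ge0}y_iq^i\in\mathbb Z_p$ ($0\le y_i<q$) put $\partial(y)=\sum_{i\ge0}iy_iq^i\in\mathbb Z_p$; for $0\le c<\ell$, $\partial(\frac{q^c}{1-q^\ell})=\frac{cq^c}{1-q^\ell}+\frac{\ell q^{\ell+c}}{(1-q^\ell)^2}\in\mathbb Q$. Put $\Pi_{\rm ari}(y)=\prod_{i\ge1}(\prod_{j=0}^{i-1}(1-\theta^{q^j}/\theta^{q^i}))^{y_i}$, $\Pi_{\rm geo}(x,y)=\prod_{i\ge0}\prod_{a\in A_+,\deg a=i}(1+x/a)^{-y_i}$. Let $\Gamma_{\rm ari}(y)=\Pi_{\rm ari}(y-1)$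 and $\Gamma^*_{\rm ari}(y)=\theta^{\partial(y-1)}\Gamma_{\rm ari}(y)$ for $y\in\mathbb Z_{(p)}$ (a rational power of $\theta$; only its absolute value $q^{\partial(y-1)}$ matters). For $N\ge0$ and $x=\sum_i\epsilon_i\theta^{-i}\in k_\infty$, $\langle x\rangle_N=1$ if $\epsilon_i=0$ for $0<i<N+1$ and $\epsilon_{N+1}=1$, else $0$; for $0\le i<\ell$ put $\langle x,\frac{q^i}{q^\ell-1}\rangle=\sum_{N\ge0,\,N\equiv-1-i\bmod\ell}\langle x\rangle_N$. For $y=1-\frac{q^i}{q^\ell-1}$, put $\partial(x,y-1)=\langle x,\frac{q^i}{q^\ell-1}\rangle$ and $$\Gamma^*(x,y)=\frac{x^{-\partial(x,y-1)}\,\Pi_{\rm geo}(x,y-1)}{\Gamma^*_{\rm ari}(y)}\quad(x\in k\setminus(-A_+\cup\{0\})),\qquad \Gamma^*(0,y)=\Gamma^*_{\rm ari}(y)^{-1}.$$ *)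

theory Defs
  imports
    "HOL-Complex_Analysis.Complex_Analysis"
    "HOL-Computational_Algebra.Formal_Laurent_Series"
    "HOL-Algebra.Elementary_Groups"
    "HOL-Algebra.Algebraic_Closure_Type"
begin

hide_const (open) Polynomials.lead_coeff Polynomials.degree up_ring.coeff up_ring.monom
  Divisibility.irreducible

text \<open>
  The finite field \<open>F\<^sub>q\<close> is a type \<open>'a\<close> of class \<open>{finite, field}\<close>, so \<open>q = CARD('a)\<close>. The ring
  \<open>F\<^sub>q[t]\<close> is \<open>'a poly\<close>, and \<open>k\<^sub>\<infinity> = F\<^sub>q((1/\<theta>))\<close> is \<open>'a fls\<close>, whose formal variable is \<open>1/\<theta>\<close>; thus
  \<open>\<theta>\<close> is \<^const>\<open>fls_X_inv\<close>, and the coefficient of \<open>\<theta>\<^sup>-\<^sup>i\<close> in \<open>x\<close> is \<open>fls_nth x i\<close>. The library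
  topology on \<open>'a fls\<close> is the one defined by the absolute value of \<open>k\<^sub>\<infinity>\<close>, so infinite products in
  \<open>k\<^sub>\<infinity>\<close> are taken with \<^const>\<open>prodinf\<close>.
\<close>

abbreviation theta :: "'a::{finite,field} fls" where
  "theta \<equiv> fls_X_inv"

definition at_theta :: "'a::{finite,field} poly \<Rightarrow> 'a fls" where
  "at_theta f = poly (map_poly fls_const f) theta"

definition kinf_abs :: "'a::{finite,field} fls \<Rightarrow> real" where
  "kinf_abs x = (if x = 0 then 0 else real CARD('a) powi (- fls_subdegree x))"

definition poly_abs :: "'a::{finite,field} poly \<Rightarrow> real" where
  "poly_abs f = kinf_abs (at_theta f)"

definition monic :: "'a::field poly \<Rightarrow> bool" where
  "monic f \<longleftrightarrow> lead_coeff f = 1"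

text \<open>
  All gamma values below lie in the algebraic closure of \<open>k\<^sub>\<infinity>\<close>, hence in the dense subfield of
  \<open>C\<^sub>\<infinity>\<close> on which its absolute value is the unique extension of \<^const>\<open>kinf_abs\<close>, namely
  \<open>|z| = |N(z)|\<^sup>1\<^sup>/\<^sup>d\<close> for \<open>z\<close> of degree \<open>d\<close> over \<open>k\<^sub>\<infinity>\<close>; up to sign, the norm \<open>N(z)\<close> is the constant
  coefficient of the minimal polynomial of \<open>z\<close>.
\<close>

definition ac_minpoly :: "'a::field alg_closure \<Rightarrow> 'a poly" where
  "ac_minpoly z =
     (THE m. monic m \<and> irreducible m \<and> poly (map_poly to_ac m) z = 0)"

definition cinf_abs :: "'a::{finite,field} fls alg_closure \<Rightarrow> real" where
  "cinf_abs z = root (degree (ac_minpoly z)) (kinf_abs (coeff (ac_minpoly z) 0))"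


text \<open>The group \<open>(A/n)\<^sup>\<times> \<times> Z/l\<close>, with residue classes given by their reduced representatives.\<close>

definition poly_unit_group :: "'a::field poly \<Rightarrow> 'a poly monoid" where
  "poly_unit_group n =
     \<lparr>carrier = {a. a mod n = a \<and> coprime a n},
      monoid.mult = (\<lambda>a b. (a * b) mod n),
      one = 1 mod n\<rparr>"

definition G_group :: "'a::field poly \<Rightarrow> nat \<Rightarrow> ('a poly \<times> int) monoid" where
  "G_group n l = poly_unit_group n \<times>\<times> integer_mod_group l"

definition complex_units :: "complex monoid" where
  "complex_units = \<lparr>carrier = UNIV - {0}, monoid.mult = (*), one = 1\<rparr>"

definition G_characters :: "'a::field poly \<Rightarrow> nat \<Rightarrow> ('a poly \<times> int \<Rightarrow> complex) set" where
  "G_characters n l = hom (G_group n l) complex_units"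

text \<open>
  \<open>modulus_of n chi d\<close> says that \<open>d\<close> is a monic divisor of \<open>n\<close> such that the restriction of \<open>chi\<close> to
  \<open>(A/n)\<^sup>\<times>\<close> factors through \<open>(A/d)\<^sup>\<times>\<close>.
\<close>

definition modulus_of :: "'a::field poly \<Rightarrow> ('a poly \<times> int \<Rightarrow> complex) \<Rightarrow> 'a poly \<Rightarrow> bool" where
  "modulus_of n chi d \<longleftrightarrow>
     monic d \<and> d dvd n \<and>
     (\<forall>a. coprime a n \<longrightarrow> a mod d = 1 mod d \<longrightarrow> chi (a mod n, 0) = 1)"

definition conductor :: "'a::field poly \<Rightarrow> ('a poly \<times> int \<Rightarrow> complex) \<Rightarrow> 'a poly" where
  "conductor n chi = (THE c. modulus_of n chi c \<and> (\<forall>d. modulus_of n chi d \<longrightarrow> c dvd d))"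

text \<open>
  \<open>chi\<close> regarded as a character of \<open>(A/c)\<^sup>\<times> \<times> Z/l\<close>, where \<open>c\<close> is its conductor. Its value at \<open>(a, m)\<close>
  is that of \<open>chi\<close> at any lift of \<open>a\<close> to \<open>(A/n)\<^sup>\<times>\<close>; it is only meant for \<open>a\<close> coprime to \<open>c\<close>.
\<close>

definition prim_char ::
    "'a::field poly \<Rightarrow> nat \<Rightarrow> ('a poly \<times> int \<Rightarrow> complex) \<Rightarrow> 'a poly \<Rightarrow> nat \<Rightarrow> complex" where
  "prim_char n l chi a m =
     (THE v. \<exists>b. coprime b n \<and> b mod conductor n chi = a mod conductor n chi \<and>
                 v = chi (b mod n, int m mod int l))"


text \<open>The Euler product converges absolutely for \<open>Re s > 1\<close>, so the primes may be grouped by degree.\<close>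

definition euler_product ::
    "'a::{finite,field} poly \<Rightarrow> nat \<Rightarrow> ('a poly \<times> int \<Rightarrow> complex) \<Rightarrow> complex \<Rightarrow> complex" where
  "euler_product n l chi s =
     (\<Prod>d. \<Prod>p | monic p \<and> irreducible p \<and> degree p = d \<and> \<not> p dvd conductor n chi.
        inverse (1 - prim_char n l chi p (degree p) * of_real (poly_abs p) powr (- s)))"

text \<open>
  A nicely meromorphic function is continuous outside its poles, which makes the continuation unique
  as a function (it takes the dummy value 0 at its poles).
\<close>

definition L_fun ::
    "'a::{finite,field} poly \<Rightarrow> nat \<Rightarrow> ('a poly \<times> int \<Rightarrow> complex) \<Rightarrow> complex \<Rightarrow> complex" where
  "L_fun n l chi =
     (THE f. f nicely_meromorphic_on UNIV \<and> (\<forall>s. Re s > 1 \<longrightarrow> f s = euler_product n l chi s))"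


text \<open>
  Elements of \<open>Z\<^sub>p\<close> only occur through the subring \<open>Z\<^sub>(\<^sub>p\<^sub>)\<close> of the rationals; as \<open>q\<close> is a power of \<open>p\<close>,
  its elements are the fractions with denominator prime to \<open>q\<close>. For \<open>r\<close> in \<open>Z\<^sub>(\<^sub>p\<^sub>)\<close>,
  \<open>q_adic_sums q c r\<close> says that the series of the \<open>c i * q ^ i\<close> converges to \<open>r\<close> in \<open>Z\<^sub>p\<close>.
\<close>

definition q_integral :: "nat \<Rightarrow> rat \<Rightarrow> bool" where
  "q_integral q r \<longleftrightarrow> coprime (snd (quotient_of r)) (int q)"

definition q_adic_sums :: "nat \<Rightarrow> (nat \<Rightarrow> nat) \<Rightarrow> rat \<Rightarrow> bool" where
  "q_adic_sums q c r \<longleftrightarrow>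
     (\<forall>n. q_integral q ((r - (\<Sum>i<n. of_nat (c i) * of_nat q ^ i)) / of_nat q ^ n))"

definition q_digit :: "nat \<Rightarrow> rat \<Rightarrow> nat \<Rightarrow> nat" where
  "q_digit q y = (THE d. (\<forall>i. d i < q) \<and> q_adic_sums q d y)"

definition digit_deriv :: "nat \<Rightarrow> rat \<Rightarrow> rat" where
  "digit_deriv q y = (THE r. q_adic_sums q (\<lambda>i. i * q_digit q y i) r)"


text \<open>The factor at \<open>i = 0\<close> is an empty product.\<close>

definition Pi_ari :: "rat \<Rightarrow> 'a::{finite,field} fls" where
  "Pi_ari y = (\<Prod>i. (\<Prod>j<i. 1 - theta ^ (CARD('a) ^ j) / theta ^ (CARD('a) ^ i))
                      ^ q_digit CARD('a) y i)"

definition Pi_geo :: "'a::{finite,field} fls \<Rightarrow> rat \<Rightarrow> 'a fls" where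
  "Pi_geo x y = (\<Prod>i. \<Prod>a | monic a \<and> degree a = i.
                   (1 + x / at_theta a) powi (- int (q_digit CARD('a) y i)))"

definition Gamma_ari :: "rat \<Rightarrow> 'a::{finite,field} fls" where
  "Gamma_ari y = Pi_ari (y - 1)"

text \<open>
  A rational power of \<open>\<theta>\<close>: for \<open>r = m / d\<close> in lowest terms, some \<open>d\<close>-th root of \<open>\<theta>\<^sup>m\<close>. The choice of
  the root does not affect the absolute value.
\<close>

definition theta_rpow :: "rat \<Rightarrow> 'a::{finite,field} fls alg_closure" where
  "theta_rpow r =
     (SOME w. w ^ nat (snd (quotient_of r)) = to_ac (theta powi fst (quotient_of r)))"

definition Gamma_ari_star :: "rat \<Rightarrow> 'a::{finite,field} fls alg_closure" where
  "Gamma_ari_star y = theta_rpow (digit_deriv CARD('a) (y - 1)) * to_ac (Gamma_ari y)"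

definition bracket :: "'a::{finite,field} fls \<Rightarrow> nat \<Rightarrow> nat" where
  "bracket x N =
     (if (\<forall>i. 0 < i \<and> i < int N + 1 \<longrightarrow> fls_nth x i = 0) \<and> fls_nth x (int N + 1) = 1
      then 1 else 0)"

text \<open>
  \<open>pairing l i x\<close> is \<open>\<langle>x, q\<^sup>i/(q\<^sup>l - 1)\<rangle>\<close>. At most one \<open>N\<close> has a nonzero bracket, so that restricting
  to nonzero terms makes the sum finite.
\<close>

definition pairing :: "nat \<Rightarrow> nat \<Rightarrow> 'a::{finite,field} fls \<Rightarrow> nat" where
  "pairing l i x =
     (\<Sum>N | int N mod int l = (- 1 - int i) mod int l \<and> bracket x N \<noteq> 0. bracket x N)"

text \<open>
  \<open>Gamma_star l i x\<close> is \<open>\<Gamma>\<^sup>*(x, y)\<close> at \<open>y = 1 - q\<^sup>i/(q\<^sup>l - 1)\<close>; the pair \<open>(l, i)\<close> with \<open>0 \<le> i < l\<close> is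
  determined by \<open>y\<close>.
\<close>

definition Gamma_star :: "nat \<Rightarrow> nat \<Rightarrow> 'a::{finite,field} fls \<Rightarrow> 'a fls alg_closure" where
  "Gamma_star l i x =
     (let y = 1 - of_nat CARD('a) ^ i / (of_nat CARD('a) ^ l - 1) in
      if x = 0 then inverse (Gamma_ari_star y)
      else to_ac (x powi (- int (pairing l i x)) * Pi_geo x (y - 1)) / Gamma_ari_star y)"

end

theory Submission
  imports Defs "HOL-Number_Theory.Cong"
begin

text \<open>
  The infinite products in the gamma values have one-units of \<open>k\<^sub>\<infinity>\<close> as factors, so
  \<open>\<bar>\<Gamma>\<^sup>*(a/c, 1 - q\<^sup>i/(q\<^sup>l - 1))\<bar>\<close> only involves the power of \<open>a/c\<close>, present exactly when \<open>a\<close> is monic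
  and \<open>i + deg c \<equiv> deg a (mod l)\<close>, and the power of \<open>\<theta>\<close> given by the digit derivative.
  On the other side \<open>L(s, \<chi>) = \<Sum>\<^sub>d S\<^sub>d (\<omega> q\<^sup>-\<^sup>s)\<^sup>d\<close>, where \<open>\<omega> = \<chi>(1, 1)\<close> and \<open>S\<^sub>d\<close> is the character sum over the
  monic \<open>a\<close> of degree \<open>d\<close>. If \<open>c \<noteq> 1\<close>, the sum stops at \<open>d < deg c\<close>, the digit derivatives cancel since
  the character sums to zero over the residues, and the formula is the identity
  \<open>-d = -deg c + (deg c - d)\<close> applied termwise. If \<open>c = 1\<close>, then \<open>L(s, \<chi>) = 1/(1 - \<omega> q\<^sup>1\<^sup>-\<^sup>s)\<close>, and the digit
  derivatives sum to its derivative at \<open>0\<close>.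
\<close>

section \<open>Polynomials over a field\<close>

text \<open>Digits, digit derivatives, minimal polynomials, conductors, primitive characters and
  \<open>L_fun\<close> are given by definite descriptions, so each needs existence and uniqueness
  before it can be computed. The digits are accessible because y - 1 = q^i/(1 - q^l) is the q-adic
  sum of q^(i + l j) over j >= 0 when y = 1 - q^i/(q^l - 1). Absolute values enter only through
  their logarithms, which are rational multiples of ln q; a root of theta is handled through a power
  of it that lies in k_infty. The Euler product is not expanded: the multiples of irreducibles of
  bounded degree are sieved out of the sum over all monic polynomials. The two cases differ because
  for c = 1 the only residue is 0 and the character is 1 there: nothing cancels, so the digit
  derivatives survive, while no power of x occurs.\<close>

lemma monic_nonzero: "monic p \<Longrightarrow> p \<noteq> 0"
  by (auto simp: monic_def)

lemma monic_mult: "monic p \<Longrightarrow> monic q \<Longrightarrow> monic (p * q)"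
  by (simp add: monic_def lead_coeff_mult)

lemma monic_1 [simp]: "monic 1"
  by (simp add: monic_def)

lemma monic_associate:
  fixes a :: "'a::field poly"
  assumes "a \<noteq> 0"
  obtains a' where "monic a'" "degree a' = degree a" "a' dvd a" "a dvd a'"
proof
  let ?a = "Polynomial.smult (inverse (lead_coeff a)) a"
  show "monic ?a" "degree ?a = degree a" using assms by (auto simp: monic_def)
  show "?a dvd a" "a dvd ?a" using assms by (auto simp: smult_dvd_iff dvd_smult)
qed

lemma monic_dvd_antisym:
  fixes a b :: "'a::field poly"
  assumes "monic a" "monic b" "a dvd b" "degree b \<le> degree a"
  shows "a = b"
proof -
  obtain k where k: "b = a * k" using assms(3) by (elim dvdE)
  have nz: "a \<noteq> 0" "k \<noteq> 0" using assms k by (auto dest: monic_nonzero)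
  then have "degree k = 0" using assms(4) k by (simp add: degree_mult_eq)
  then obtain e where e: "k = [:e:]" by (rule degree_eq_zeroE)
  have "lead_coeff b = lead_coeff a * lead_coeff k" by (simp only: k lead_coeff_mult)
  then have "e = 1" using assms e by (simp add: monic_def)
  then show ?thesis using k e by (simp add: one_pCons[symmetric])
qed

lemma monic_degree_0: "monic p \<Longrightarrow> degree p = 0 \<Longrightarrow> p = 1" for p :: "'a::field poly"
  using monic_dvd_antisym[of 1 p] by simp

text \<open>A nonzero element of least degree in the ideal generated by \<open>a\<close> and
  \<open>b\<close> divides the whole ideal, by division with remainder. The explicit combination is
  what the arguments on coprimality and on conductors use.\<close>

lemma poly_bezout:
  fixes a b :: "'a::field poly"
  assumes "a \<noteq> 0 \<or> b \<noteq> 0"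
  obtains g x y where "monic g" "g = a * x + b * y" "g dvd a" "g dvd b"
proof -
  define I where "I = {a * x + b * y | x y. True}"
  have I_mult: "p * k \<in> I" if p: "p \<in> I" for p k
  proof -
    obtain x y where "p = a * x + b * y" using p by (auto simp: I_def)
    then have "p * k = a * (x * k) + b * (y * k)" by (simp add: algebra_simps)
    then show ?thesis unfolding I_def by blast
  qed
  have I_diff: "p - r \<in> I" if pr: "p \<in> I" "r \<in> I" for p r
  proof -
    obtain x y x' y' where "p = a * x + b * y" "r = a * x' + b * y'" using pr by (auto simp: I_def)
    then have "p - r = a * (x - x') + b * (y - y')" by (simp add: algebra_simps)
    then show ?thesis unfolding I_def by blast
  qed
  have aI: "a \<in> I" unfolding I_def by (rule CollectI, intro exI[of _ 1] exI[of _ 0]) simp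
  have bI: "b \<in> I" unfolding I_def by (rule CollectI, intro exI[of _ 0] exI[of _ 1]) simp
  have "\<exists>p. p \<in> I \<and> p \<noteq> 0" using assms aI bI by auto
  from ex_has_least_nat[of "\<lambda>p. p \<in> I \<and> p \<noteq> 0" _ degree] this
  obtain r where r: "r \<in> I" "r \<noteq> 0" and least: "\<And>p. p \<in> I \<Longrightarrow> p \<noteq> 0 \<Longrightarrow> degree r \<le> degree p"
    by blast
  have dvd: "r dvd p" if "p \<in> I" for p
  proof -
    have "p mod r = p - r * (p div r)" by (simp add: minus_mult_div_eq_mod)
    then have "p mod r \<in> I" using that r(1) I_mult I_diff by simp
    moreover have "p mod r = 0 \<or> degree (p mod r) < degree r" using r(2) by (rule degree_mod_less)
    ultimately show ?thesis using least by (metis dvd_eq_mod_eq_0 not_less)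
  qed
  obtain g where g: "monic g" "g dvd r" "r dvd g" using monic_associate[OF r(2)] by blast
  obtain k where "g = r * k" using g(3) by (elim dvdE)
  then have "g \<in> I" using r I_mult by simp
  then obtain x y where "g = a * x + b * y" by (auto simp: I_def)
  moreover have "g dvd a" "g dvd b" using dvd aI bI g(2) dvd_trans by blast+
  ultimately show thesis using that g(1) by blast
qed

lemma coprime_bezout:
  fixes a b :: "'a::field poly"
  shows "coprime a b \<longleftrightarrow> (\<exists>x y. a * x + b * y = 1)"
proof
  assume cop: "coprime a b"
  then have "a \<noteq> 0 \<or> b \<noteq> 0" by auto
  from poly_bezout[OF this] obtain g x y where g: "monic g" "g = a * x + b * y" "g dvd a" "g dvd b"
    by metis
  then have "is_unit g" using cop coprime_common_divisor by blast
  then obtain h where "1 = g * h" by (elim dvdE)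
  then have "a * (x * h) + b * (y * h) = 1" using g(2) by (simp add: algebra_simps)
  then show "\<exists>x y. a * x + b * y = 1" by blast
next
  assume "\<exists>x y. a * x + b * y = 1"
  then show "coprime a b" by (metis coprimeI dvd_add dvd_mult2)
qed

lemma poly_coprime_mult_left:
  fixes a b n :: "'a::field poly"
  shows "coprime (a * b) n \<longleftrightarrow> coprime a n \<and> coprime b n"
proof
  assume "coprime a n \<and> coprime b n"
  then obtain x y z w where "a * x + n * y = 1" "b * z + n * w = 1" by (auto simp: coprime_bezout)
  then have "(a * x + n * y) * (b * z + n * w) = 1" by simp
  then have "(a * b) * (x * z) + n * (a * x * w + y * (b * z + n * w)) = 1"
    by (simp add: algebra_simps)
  then show "coprime (a * b) n" unfolding coprime_bezout by blast
qed (auto intro: coprime_divisors[of _ "a * b" n n])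

lemma poly_coprime_cong:
  fixes a b n :: "'a::field poly"
  assumes "a mod n = b mod n"
  shows "coprime a n \<longleftrightarrow> coprime b n"
  using assms by (cases "n = 0") (simp, metis coprime_mod_left_iff)

lemma poly_inverse_mod:
  fixes b n :: "'a::field poly"
  assumes "coprime b n"
  obtains b' where "coprime b' n" "(b * b') mod n = 1 mod n"
proof -
  obtain x y where xy: "b * x + n * y = 1" using assms by (auto simp: coprime_bezout)
  then have "coprime x n" unfolding coprime_bezout by (metis mult.commute)
  moreover have "(b * x) mod n = 1 mod n" by (simp flip: xy)
  ultimately show thesis by (rule that)
qed

text \<open>A monic divisor of least positive degree cannot split, since a proper nonunit factor
  would yield a smaller one.\<close>

lemma monic_irreducible_factor:
  fixes a :: "'a::field poly"
  assumes "a \<noteq> 0" "\<not> is_unit a"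
  obtains p where "monic p" "irreducible p" "p dvd a"
proof -
  define Q where "Q p \<longleftrightarrow> monic p \<and> degree p > 0 \<and> p dvd a" for p
  have deg_pos: "degree b > 0" if "b dvd a" "\<not> is_unit b" for b
    using that assms is_unit_iff_degree[of b] by auto
  have Q: "\<exists>p. Q p \<and> degree p = degree b" if b: "b dvd a" "\<not> is_unit b" for b
  proof -
    have "b \<noteq> 0" using b assms by auto
    then obtain b' where "monic b'" "degree b' = degree b" "b' dvd b" using monic_associate by blast
    then show ?thesis using deg_pos[OF b] b dvd_trans unfolding Q_def by metis
  qed
  have "\<exists>p. Q p" using Q[of a] assms dvd_refl by blast
  from ex_has_least_nat[of Q _ degree] this
  obtain p where p: "Q p" and least: "\<And>r. Q r \<Longrightarrow> degree p \<le> degree r" by blast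
  have p0: "p \<noteq> 0" using p by (auto simp: Q_def)
  have "irreducible p"
  proof (rule Factorial_Ring.irreducibleI)
    show "p \<noteq> 0" "\<not> is_unit p" using p p0 by (auto simp: Q_def is_unit_iff_degree)
    fix b d assume bd: "p = b * d"
    then have nz: "b \<noteq> 0" "d \<noteq> 0" using p0 by auto
    show "is_unit b \<or> is_unit d"
    proof (rule ccontr)
      assume *: "\<not> (is_unit b \<or> is_unit d)"
      have "b dvd a" using p bd unfolding Q_def by (metis dvd_mult_left)
      then obtain r where "Q r" "degree r = degree b" using Q * by blast
      then have "degree p \<le> degree b" using least by fastforce
      then show False using bd nz * by (simp add: degree_mult_eq is_unit_iff_degree)
    qed
  qed
  then show thesis using that p by (auto simp: Q_def)
qed

lemma irreducible_coprime_or_dvd: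
  fixes p b :: "'a::field poly"
  assumes "irreducible p" "\<not> p dvd b"
  shows "coprime p b"
proof (rule coprimeI)
  fix d assume d: "d dvd p" "d dvd b"
  then obtain k where k: "p = d * k" by (elim dvdE)
  show "is_unit d"
  proof (rule ccontr)
    assume "\<not> is_unit d"
    then have "is_unit k" using assms(1) k Factorial_Ring.irreducibleD by blast
    then have "p dvd d" using k by (simp add: mult_unit_dvd_iff)
    then show False using assms(2) d dvd_trans by blast
  qed
qed

lemma irreducible_dvd_mult:
  fixes p :: "'a::field poly"
  assumes "irreducible p" "p dvd a * b"
  shows "p dvd a \<or> p dvd b"
  using field_poly_irreducible_imp_prime[OF assms(1)] assms(2) by (rule prime_elem_dvd_multD)

text \<open>
  Adding to \<open>b\<close> the multiple \<open>m * k\<close>, where \<open>k\<close> is a largest divisor of \<open>n\<close> prime to \<open>b\<close>: every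
  irreducible factor of \<open>n\<close> divides exactly one of \<open>b\<close> and \<open>m * k\<close>.
\<close>
lemma lift_coprime:
  fixes b m n :: "'a::field poly"
  assumes "coprime b m" "m dvd n" "n \<noteq> 0"
  obtains b' where "coprime b' n" "b' mod m = b mod m"
proof -
  define Q where "Q k \<longleftrightarrow> k dvd n \<and> coprime k b" for k
  have "\<exists>k. Q k" unfolding Q_def by (rule exI[of _ 1]) simp
  moreover have "\<forall>k. Q k \<longrightarrow> degree k < Suc (degree n)"
    using assms(3) by (auto simp: Q_def less_Suc_eq_le intro: dvd_imp_degree_le)
  ultimately obtain k where k: "Q k" and greatest: "\<And>j. Q j \<Longrightarrow> degree j \<le> degree k"
    using ex_has_greatest_nat[of Q _ degree "Suc (degree n)"] by blast
  have "coprime (b + m * k) n"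
  proof (rule ccontr)
    assume "\<not> coprime (b + m * k) n"
    then obtain d where d: "d dvd b + m * k" "d dvd n" "\<not> is_unit d" by (auto simp: coprime_def)
    then have "d \<noteq> 0" using assms(3) by auto
    then obtain p where p: "irreducible p" "p dvd d" using monic_irreducible_factor d(3) by blast
    have p0: "p \<noteq> 0" and deg_p: "degree p > 0"
    proof -
      show "p \<noteq> 0" using p by auto
      then show "degree p > 0" using irreducible_not_unit[OF p(1)] is_unit_iff_degree by blast
    qed
    have not_unit: "\<not> is_unit p" by (rule irreducible_not_unit[OF p(1)])
    have pd: "p dvd b + m * k" "p dvd n" using p(2) d dvd_trans by blast+
    show False
    proof (cases "p dvd b")
      case True
      then have "p dvd m * k" using pd(1) by (simp add: dvd_add_right_iff)
      then have "p dvd m \<or> p dvd k" using p(1) irreducible_dvd_mult by blast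
      then show False
        using True not_unit assms(1) k coprime_common_divisor[of b m p] coprime_common_divisor[of k b p]
        by (auto simp: Q_def)
    next
      case False
      then have pk: "\<not> p dvd k" using pd(1) by (metis dvd_add_left_iff dvd_mult)
      obtain j where j: "n = k * j" using k by (auto simp: Q_def)
      then have "p dvd j" using pd(2) pk p(1) irreducible_dvd_mult by blast
      then have "k * p dvd n" using j by (simp add: mult_dvd_mono)
      moreover have "coprime (k * p) b"
        using k irreducible_coprime_or_dvd[OF p(1) False] by (simp add: poly_coprime_mult_left Q_def)
      ultimately have "degree (k * p) \<le> degree k" using greatest by (simp add: Q_def)
      moreover have "k \<noteq> 0" using j assms(3) by auto
      ultimately show False using p0 deg_p by (simp add: degree_mult_eq)
    qed
  qed
  then show thesis by (rule that) simp
qed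

text \<open>The zero polynomial is listed apart because its \<open>degree\<close> is 0. Hence
  \<open>polys_below (degree c)\<close> is a complete residue system modulo a nonzero
  \<open>c\<close> even for c = 1, where it is {0}.\<close>

definition polys_below :: "nat \<Rightarrow> 'a::field poly set" where
  "polys_below d = {p. p = 0 \<or> degree p < d}"

definition monics :: "nat \<Rightarrow> 'a::field poly set" where
  "monics d = {p. monic p \<and> degree p = d}"

lemma polys_below_Suc: "polys_below (Suc d) = (\<lambda>(a, p). pCons a p) ` (UNIV \<times> polys_below d)"
proof (intro equalityI subsetI)
  fix p :: "'a poly" assume p: "p \<in> polys_below (Suc d)"
  obtain a r where r: "p = pCons a r" by (cases p)
  then have "r \<in> polys_below d" using p by (auto simp: polys_below_def split: if_splits)
  then show "p \<in> (\<lambda>(a, p). pCons a p) ` (UNIV \<times> polys_below d)" using r by force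
qed (auto simp: polys_below_def split: if_splits)

lemma polys_below_0: "polys_below 0 = {0}"
  by (simp add: polys_below_def)

lemma finite_card_polys_below:
  "finite (polys_below d :: 'a::{finite,field} poly set) \<and>
   card (polys_below d :: 'a poly set) = CARD('a) ^ d"
proof (induction d)
  case (Suc d)
  have "inj_on (\<lambda>(a, p). pCons a p) (UNIV \<times> polys_below d :: ('a \<times> 'a poly) set)"
    by (auto simp: inj_on_def)
  then show ?case using Suc by (simp add: polys_below_Suc card_image card_cartesian_product)
qed (simp add: polys_below_0)

lemma monics_eq_image: "monics d = (\<lambda>p. monom 1 d + p) ` polys_below d"
proof (intro equalityI subsetI)
  fix p :: "'a poly" assume p: "p \<in> monics d"
  then have lead: "coeff p d = 1" and deg: "degree p = d" by (auto simp: monics_def monic_def)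
  have "p - monom 1 d \<in> polys_below d"
  proof (cases "p = monom 1 d")
    case False
    have "degree (p - monom 1 d) \<le> d" using deg by (intro degree_diff_le) (auto simp: degree_monom_le)
    moreover have "coeff (p - monom 1 d) d = 0" using lead by simp
    ultimately have "degree (p - monom 1 d) < d"
      using False by (metis eq_iff_diff_eq_0 le_neq_implies_less leading_coeff_0_iff)
    then show ?thesis by (simp add: polys_below_def)
  qed (simp add: polys_below_def)
  then show "p \<in> (\<lambda>p. monom 1 d + p) ` polys_below d" by (intro image_eqI[of _ _ "p - monom 1 d"]) auto
next
  fix p :: "'a poly" assume "p \<in> (\<lambda>p. monom 1 d + p) ` polys_below d"
  then obtain r where r: "p = monom 1 d + r" "r = 0 \<or> degree r < d" by (auto simp: polys_below_def)
  have "coeff r d = 0" using r(2) by (auto intro: coeff_eq_0)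
  then have c: "coeff p d = 1" using r by simp
  have "degree p \<le> d" unfolding r(1) using r(2)
    by (intro degree_add_le) (auto simp: degree_monom_le)
  moreover have "degree p \<ge> d" using c by (intro le_degree) simp
  ultimately have "degree p = d" by simp
  then show "p \<in> monics d" using c by (simp add: monics_def monic_def)
qed

lemma finite_monics [simp]: "finite (monics d :: 'a::{finite,field} poly set)"
  using finite_card_polys_below[of d, where 'a = 'a] by (simp add: monics_eq_image)

lemma card_monics: "card (monics d :: 'a::{finite,field} poly set) = CARD('a) ^ d"
  using finite_card_polys_below[of d, where 'a = 'a]
  by (simp add: monics_eq_image card_image inj_on_def)

lemma mod_in_polys_below: "c \<noteq> 0 \<Longrightarrow> a mod c \<in> polys_below (degree c)"
  using degree_mod_less[of c a] by (auto simp: polys_below_def)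

lemma mod_polys_below: "r \<in> polys_below (degree c) \<Longrightarrow> r mod c = r"
  by (auto simp: polys_below_def mod_poly_less)

lemma leading_term_add:
  assumes "degree r < degree p \<or> r = 0"
  shows "degree (p + r) = degree p \<and> lead_coeff (p + r) = lead_coeff p"
proof (cases "r = 0")
  case False
  then have r: "degree r < degree p" using assms by simp
  then have "degree (p + r) = degree p" by (rule degree_add_eq_left)
  then show ?thesis using r by (simp add: coeff_eq_0)
qed simp

text \<open>Division by \<open>c\<close> is a bijection from the monic polynomials of degree
  \<open>d\<close> to pairs of a monic quotient of degree \<open>d - degree c\<close> and an
  arbitrary remainder, so every residue occurs equally often.\<close>

lemma sum_monics_periodic:
  fixes F :: "'a::{finite,field} poly \<Rightarrow> 'b::comm_semiring_1"
  assumes c: "monic c" and d: "d \<ge> degree c" and F: "\<And>a. F (a mod c) = F a"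
  shows "sum F (monics d) = of_nat (CARD('a) ^ (d - degree c)) * sum F (polys_below (degree c))"
proof -
  have c0: "c \<noteq> 0" using c by (rule monic_nonzero)
  have below: "degree r < degree (c * g) \<or> (r = 0)" if "g \<in> monics k" "r \<in> polys_below (degree c)" for g r k
  proof -
    have "g \<noteq> 0" using that(1) by (auto simp: monics_def dest: monic_nonzero)
    then show ?thesis using that(2) c0 by (auto simp: polys_below_def degree_mult_eq)
  qed
  have "sum F (monics d) = (\<Sum>(g, r)\<in>(monics (d - degree c) :: 'a poly set) \<times> polys_below (degree c). F r)"
  proof (rule sum.reindex_bij_witness[where i = "\<lambda>(g, r). c * g + r" and j = "\<lambda>a. (a div c, a mod c)"])
    fix a :: "'a poly" assume a: "a \<in> monics d"
    show "(case (a div c, a mod c) of (g, r) \<Rightarrow> c * g + r) = a" by simp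
    have a0: "a div c \<noteq> 0"
    proof
      assume "a div c = 0"
      then have "a mod c = a" using div_mult_mod_eq[of a c] by simp
      then have "a \<in> polys_below (degree c)" using mod_in_polys_below[OF c0, of a] by simp
      then show False using a d monic_nonzero by (auto simp: polys_below_def monics_def)
    qed
    have below_a: "degree (a mod c) < degree (c * (a div c)) \<or> a mod c = 0"
      using mod_in_polys_below[OF c0, of a] a0 c0 by (auto simp: polys_below_def degree_mult_eq)
    from leading_term_add[OF this, unfolded mult_div_mod_eq]
    have deg_a: "degree a = degree (c * (a div c))" and lead_a: "lead_coeff a = lead_coeff (c * (a div c))"
      by blast+
    have "degree a = degree c + degree (a div c)"
      unfolding deg_a by (rule degree_mult_eq[OF c0 a0])
    moreover have "degree a = d" using a by (simp add: monics_def)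
    ultimately have deg: "degree (a div c) = d - degree c" by linarith
    have "lead_coeff a = lead_coeff c * lead_coeff (a div c)"
      unfolding lead_a by (rule lead_coeff_mult)
    then have "monic (a div c)" using a c by (simp add: monic_def monics_def)
    then show "(a div c, a mod c) \<in> monics (d - degree c) \<times> polys_below (degree c)"
      using deg mod_in_polys_below[OF c0] by (simp add: monics_def)
    show "(case (a div c, a mod c) of (g, r) \<Rightarrow> F r) = F a" using F by simp
  next
    fix gr :: "'a poly \<times> 'a poly" assume "gr \<in> monics (d - degree c) \<times> polys_below (degree c)"
    then obtain g r where gr: "gr = (g, r)" "g \<in> monics (d - degree c)" "r \<in> polys_below (degree c)" by auto
    have rc: "r mod c = r" using gr(3) by (rule mod_polys_below)
    then have "r div c = 0" using c0 gr(3) by (auto simp: polys_below_def div_poly_less)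
    then show "((case gr of (g, r) \<Rightarrow> c * g + r) div c, (case gr of (g, r) \<Rightarrow> c * g + r) mod c) = gr"
      using gr rc c0 by (simp add: mult.commute[of c])
    have g: "monic g" "degree g = d - degree c" using gr by (auto simp: monics_def)
    have "degree (c * g) = d" using g c0 d monic_nonzero[OF g(1)] by (simp add: degree_mult_eq)
    moreover have "degree (c * g + r) = degree (c * g)" "lead_coeff (c * g + r) = lead_coeff (c * g)"
      using leading_term_add[OF below[OF gr(2,3)]] by auto
    ultimately show "(case gr of (g, r) \<Rightarrow> c * g + r) \<in> monics d"
      using monic_mult[OF c g(1)] gr by (simp add: monics_def monic_def)
  qed
  also have "\<dots> = (\<Sum>g\<in>(monics (d - degree c) :: 'a poly set). sum F (polys_below (degree c)))"
    by (rule sum.cartesian_product[symmetric])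
  finally show ?thesis by (simp add: card_monics)
qed

section \<open>Digit expansions\<close>

text \<open>\<open>q_integral\<close> refers to the reduced denominator; this form accepts any
  fraction, since the reduced denominator divides every other one.\<close>

lemma q_integral_iff:
  "q_integral q r \<longleftrightarrow> (\<exists>a b. b \<noteq> 0 \<and> coprime b (int q) \<and> r = of_int a / of_int b)"
proof
  assume *: "q_integral q r"
  obtain a b where ab: "quotient_of r = (a, b)" by (cases "quotient_of r")
  then have "b > 0" "r = of_int a / of_int b"
    using quotient_of_denom_pos[OF ab] quotient_of_div[OF ab] by auto
  moreover have "coprime b (int q)" using * ab by (simp add: q_integral_def)
  ultimately show "\<exists>a b. b \<noteq> 0 \<and> coprime b (int q) \<and> r = of_int a / of_int b"
    by (intro exI[of _ a] exI[of _ b]) simp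
next
  assume "\<exists>a b. b \<noteq> 0 \<and> coprime b (int q) \<and> r = of_int a / of_int b"
  then obtain a b where ab: "b \<noteq> 0" "coprime b (int q)" "r = of_int a / of_int b" by blast
  obtain a' b' where ab': "quotient_of r = (a', b')" by (cases "quotient_of r")
  then have pos: "b' > 0" and r: "r = of_int a' / of_int b'" and cop: "coprime a' b'"
    using quotient_of_denom_pos[OF ab'] quotient_of_div[OF ab'] quotient_of_coprime[OF ab'] by auto
  have "of_int (a * b') = (of_int (a' * b) :: rat)"
    using ab r pos by (simp add: field_simps)
  then have "a * b' = a' * b" by (simp only: of_int_eq_iff)
  then have "b' dvd a' * b" by (metis dvd_triv_right)
  then have "b' dvd b" using cop by (simp add: coprime_commute coprime_dvd_mult_right_iff)
  then have "coprime b' (int q)" using ab(2) by (meson coprime_divisors dvd_refl)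
  then show "q_integral q r" using ab' by (simp add: q_integral_def)
qed

lemma q_integral_diff:
  assumes "q_integral q r" "q_integral q s"
  shows "q_integral q (r - s)"
proof -
  obtain a b a' b' where "b \<noteq> 0" "coprime b (int q)" "r = of_int a / of_int b"
      "b' \<noteq> 0" "coprime b' (int q)" "s = of_int a' / of_int b'"
    using assms unfolding q_integral_iff by metis
  then have "b * b' \<noteq> 0 \<and> coprime (b * b') (int q) \<and>
      r - s = of_int (a * b' - a' * b) / of_int (b * b')"
    by (simp add: diff_frac_eq)
  then show ?thesis unfolding q_integral_iff by blast
qed

lemma q_integral_div_power_imp_dvd:
  assumes "q_integral q (of_int k / of_int m / of_nat q ^ n)" "q > 0" "m \<noteq> 0"
  shows "int q ^ n dvd k"
proof -
  obtain a b where ab: "b \<noteq> 0" "coprime b (int q)"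
      "of_int k / of_int m / of_nat q ^ n = (of_int a / of_int b :: rat)"
    using assms unfolding q_integral_iff by metis
  then have "of_int (k * b) = (of_int (a * m * int q ^ n) :: rat)"
    using assms by (simp add: field_simps)
  then have "k * b = a * m * int q ^ n" by (simp only: of_int_eq_iff)
  then have "int q ^ n dvd k * b" by (metis dvd_triv_right)
  then show ?thesis using ab(2)
    by (simp add: coprime_commute coprime_dvd_mult_left_iff)
qed

text \<open>The difference a/b of two limits is divisible by every power of \<open>q\<close>; the
  exponent n = |a| already gives q^n > |a|, hence a = 0. This justifies the description in
  \<open>digit_deriv\<close>, whose coefficients may exceed q - 1.\<close>

lemma q_adic_sums_unique:
  assumes "q_adic_sums q c r" "q_adic_sums q c s" "q \<ge> 2"
  shows "r = s"
proof -
  obtain a b where ab: "quotient_of (r - s) = (a, b)" by (cases "quotient_of (r - s)")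
  then have b: "b > 0" and rs: "r - s = of_int a / of_int b"
    using quotient_of_denom_pos[OF ab] quotient_of_div[OF ab] by auto
  define n where "n = nat \<bar>a\<bar>"
  have "q_integral q ((r - (\<Sum>i<n. of_nat (c i) * of_nat q ^ i)) / of_nat q ^ n -
      (s - (\<Sum>i<n. of_nat (c i) * of_nat q ^ i)) / of_nat q ^ n)"
    using assms unfolding q_adic_sums_def by (intro q_integral_diff) auto
  also have "(r - (\<Sum>i<n. of_nat (c i) * of_nat q ^ i)) / of_nat q ^ n -
      (s - (\<Sum>i<n. of_nat (c i) * of_nat q ^ i)) / of_nat q ^ n =
      of_int a / of_int b / of_nat q ^ n"
    by (simp flip: rs diff_divide_distrib)
  finally have dvd: "int q ^ n dvd a"
    using q_integral_div_power_imp_dvd assms(3) b by simp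
  have "\<bar>a\<bar> < int q ^ n"
  proof -
    have "n < 2 ^ n" by (rule less_exp)
    also have "2 ^ n \<le> q ^ n" using assms(3) by (rule power_mono) simp
    finally have "int n < int (q ^ n)" by linarith
    then show ?thesis by (simp add: n_def)
  qed
  then have "a = 0" using dvd_imp_le_int[OF _ dvd] by (cases "a = 0") auto
  then show ?thesis using rs by simp
qed

text \<open>If the digits agree below n, the two remainders after n + 1 digits differ by (d n - e
  n)/q. Its integrality forces equality of two numbers between 0 and q - 1.\<close>

lemma q_digits_unique:
  assumes d: "\<And>i. d i < q" "q_adic_sums q d y"
    and e: "\<And>i. e i < q" "q_adic_sums q e y"
  shows "d = e"
proof
  fix n
  have q: "q > 0" using d(1)[of 0] by simp
  show "d n = e n"
  proof (induction n rule: less_induct)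
    case (less n)
    define S where "S = (\<Sum>i<n. of_nat (d i) * of_nat q ^ i :: rat)"
    have "S = (\<Sum>i<n. of_nat (e i) * of_nat q ^ i)"
      unfolding S_def using less by (intro sum.cong) auto
    then have eq: "(y - (\<Sum>i<Suc n. of_nat (e i) * of_nat q ^ i)) / of_nat q ^ Suc n -
      (y - (\<Sum>i<Suc n. of_nat (d i) * of_nat q ^ i)) / of_nat q ^ Suc n =
      of_int (int (d n) - int (e n)) / of_int 1 / of_nat q ^ 1"
      using q by (simp add: S_def[symmetric] field_simps)
    have "q_integral q ((y - (\<Sum>i<Suc n. of_nat (e i) * of_nat q ^ i)) / of_nat q ^ Suc n -
      (y - (\<Sum>i<Suc n. of_nat (d i) * of_nat q ^ i)) / of_nat q ^ Suc n)"
      using d(2) e(2) unfolding q_adic_sums_def by (intro q_integral_diff) blast+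
    then have "int q ^ 1 dvd int (d n) - int (e n)"
      unfolding eq by (rule q_integral_div_power_imp_dvd) (use q in auto)
    then have "int (d n) mod int q = int (e n) mod int q"
      by (simp add: mod_eq_dvd_iff)
    then show ?case using d(1)[of n] e(1)[of n] by simp
  qed
qed

text \<open>The remainders of the expansions below have powers of 1 - q^l as denominators, and these
  are 1 modulo \<open>q\<close>. The exponent is 1 for the number itself and 2 for its digit
  derivative.\<close>

lemma q_integral_over_one_minus_power:
  assumes "q \<ge> 2" "l \<ge> 1"
  shows "q_integral q (of_int k / (1 - of_nat q ^ l) ^ m)"
proof -
  have "coprime (1 - int q ^ l) (int q)"
  proof (rule coprimeI)
    fix c assume c: "c dvd 1 - int q ^ l" "c dvd int q"
    then have "c dvd int q ^ l" using assms by (meson dvd_power dvd_trans less_le_trans zero_less_one)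
    then have "c dvd (1 - int q ^ l) + int q ^ l" using c by (intro dvd_add)
    then show "is_unit c" by simp
  qed
  then have "coprime ((1 - int q ^ l) ^ m) (int q)" by simp
  moreover have "int q ^ l \<noteq> 1"
  proof -
    have "1 < int q ^ l" using assms by (intro one_less_power) auto
    then show ?thesis by simp
  qed
  ultimately show ?thesis
    unfolding q_integral_iff
    by (intro exI[of _ k] exI[of _ "(1 - int q ^ l) ^ m"]) auto
qed

text \<open>These are the digits of q^i/(1 - q^l) for i < l.\<close>

definition periodic_digit :: "nat \<Rightarrow> nat \<Rightarrow> nat \<Rightarrow> nat" where
  "periodic_digit l i k = (if k mod l = i then 1 else 0)"

text \<open>The q-adic sum of (i + l j) q^(i + l j) over j >= 0. The field is left open because the
  value is needed in \<open>rat\<close> and, for logarithms, in \<open>real\<close>.\<close>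

definition digit_deriv_value :: "nat \<Rightarrow> nat \<Rightarrow> nat \<Rightarrow> 'b::field" where
  "digit_deriv_value q l i = of_nat i * of_nat q ^ i / (1 - of_nat q ^ l) +
     of_nat l * of_nat q ^ (l + i) / (1 - of_nat q ^ l) ^ 2"

text \<open>
  After removing \<open>n\<close> digits, the shifted expansion is again purely periodic, with offset
  \<open>(i - n) mod l\<close>.
\<close>
lemma periodic_remainder:
  assumes "q \<ge> 2" "i < l"
  defines "Q \<equiv> of_nat q ^ l :: rat"
  shows "\<exists>e<l. (n + e) mod l = i \<and>
     (of_nat q ^ i / (1 - Q) - (\<Sum>k<n. of_nat (periodic_digit l i k) * of_nat q ^ k)) / of_nat q ^ n
       = of_nat q ^ e / (1 - Q) \<and>
     (digit_deriv_value q l i - (\<Sum>k<n. of_nat (k * periodic_digit l i k) * of_nat q ^ k)) / of_nat q ^ n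
       = of_nat n * of_nat q ^ e / (1 - Q) + digit_deriv_value q l e"
proof (induction n)
  case 0
  then show ?case using assms by (intro exI[of _ i]) auto
next
  case (Suc n)
  define S where "S = (\<Sum>k<n. of_nat (periodic_digit l i k) * of_nat q ^ k :: rat)"
  define T where "T = (\<Sum>k<n. of_nat (k * periodic_digit l i k) * of_nat q ^ k :: rat)"
  define q' where "q' = (of_nat q :: rat)"
  have q0: "q' \<noteq> 0" using assms by (simp add: q'_def)
  have l0: "l > 0" using assms by simp
  have Q1: "1 - Q \<noteq> 0"
  proof -
    have "1 < q ^ l" using assms by (intro one_less_power) auto
    then have "(1::rat) < of_nat (q ^ l)" by (metis of_nat_1 of_nat_less_iff)
    then show ?thesis by (simp add: Q_def)
  qed
  \<comment> \<open>A digit with index j in the shifted expansion had index n + j before. Weighting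
    by the index therefore adds \<open>n\<close> times the shifted number to the shifted digit
    derivative.\<close>
  from Suc obtain e where e: "e < l" "(n + e) mod l = i"
    and S: "(q' ^ i / (1 - Q) - S) / q' ^ n = q' ^ e / (1 - Q)"
    and T: "(digit_deriv_value q l i - T) / q' ^ n = of_nat n * q' ^ e / (1 - Q) + digit_deriv_value q l e"
    unfolding S_def T_def q'_def by blast
  have S': "(q' ^ i / (1 - Q) - (S + of_nat d * q' ^ n)) / q' ^ Suc n = (q' ^ e / (1 - Q) - of_nat d) / q'" for d
    unfolding S[symmetric] using q0 by (simp add: field_simps)
  have T': "(digit_deriv_value q l i - (T + of_nat d * q' ^ n)) / q' ^ Suc n =
      (of_nat n * q' ^ e / (1 - Q) + digit_deriv_value q l e - of_nat d) / q'" for d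
    unfolding T[symmetric] using q0 by (simp add: field_simps)
  have DD: "digit_deriv_value q l e =
      of_nat e * q' ^ e / (1 - Q) + of_nat l * Q * q' ^ e / (1 - Q)\<^sup>2" for e
    by (simp add: digit_deriv_value_def Q_def q'_def power_add)
  show ?case
  proof (cases e)
    \<comment> \<open>The digit at \<open>n\<close> is 1; removing it leaves 1/(1 - Q) - 1 = Q/(1 -
      Q), which division by q turns into q^(l - 1)/(1 - Q).\<close>
    case 0
    have dig: "periodic_digit l i n = 1" using e 0 by (simp add: periodic_digit_def)
    have Qq: "Q = q' * q' ^ (l - 1)" using l0 by (simp add: Q_def q'_def power_eq_if)
    show ?thesis
    proof (intro exI[of _ "l - 1"] conjI)
      show "l - 1 < l" using l0 by simp
      show "(Suc n + (l - 1)) mod l = i" using e 0 l0 by simp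
      have "(q' ^ i / (1 - Q) - (S + of_nat 1 * q' ^ n)) / q' ^ Suc n = q' ^ (l - 1) / (1 - Q)"
        unfolding S' using 0 q0 Q1 Qq by (simp add: field_simps)
      then show "(of_nat q ^ i / (1 - Q) - (\<Sum>k<Suc n. of_nat (periodic_digit l i k) * of_nat q ^ k)) /
          of_nat q ^ Suc n = of_nat q ^ (l - 1) / (1 - Q)"
        by (simp add: S_def q'_def dig)
      have "(of_nat n * q' ^ e / (1 - Q) + digit_deriv_value q l e - of_nat n) =
          q' * (of_nat (Suc n) * q' ^ (l - 1) / (1 - Q) + digit_deriv_value q l (l - 1))"
      proof -
        have "q' * (of_nat (Suc n) * q' ^ (l - 1) / (1 - Q) + digit_deriv_value q l (l - 1)) =
            of_nat (Suc n) * Q / (1 - Q) + (of_nat l - 1) * Q / (1 - Q) + of_nat l * Q * Q / (1 - Q)\<^sup>2"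
          unfolding DD using l0 by (simp add: Qq algebra_simps of_nat_diff)
        also have "\<dots> = of_nat n / (1 - Q) - of_nat n + of_nat l * Q / (1 - Q)\<^sup>2"
        proof -
          define R where "R = 1 - Q"
          have "Q = 1 - R" "R \<noteq> 0" using Q1 by (auto simp: R_def)
          then show ?thesis unfolding \<open>Q = 1 - R\<close>
            by (simp add: field_simps power2_eq_square)
        qed
        finally show ?thesis unfolding DD using 0 by simp
      qed
      then have "(digit_deriv_value q l i - (T + of_nat n * q' ^ n)) / q' ^ Suc n =
          of_nat (Suc n) * q' ^ (l - 1) / (1 - Q) + digit_deriv_value q l (l - 1)"
        unfolding T' using q0 by (simp add: nonzero_divide_eq_eq mult.commute)
      then show "(digit_deriv_value q l i - (\<Sum>k<Suc n. of_nat (k * periodic_digit l i k) * of_nat q ^ k)) / of_nat q ^ Suc n =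
          of_nat (Suc n) * of_nat q ^ (l - 1) / (1 - Q) + digit_deriv_value q l (l - 1)"
        by (simp add: T_def q'_def dig)
    qed
  next
    case (Suc e')
    \<comment> \<open>Since 0 < e < l and n + e is congruent to \<open>i\<close>, the digit at
      \<open>n\<close> is 0, and the shift merely lowers the offset by 1.\<close>
    have "n mod l \<noteq> i"
    proof
      assume "n mod l = i"
      then have "[n + e = n + 0] (mod l)" using e by (simp add: cong_def)
      then have "[e = 0] (mod l)" by (simp only: cong_add_lcancel_nat)
      then show False using e Suc by (simp add: cong_def)
    qed
    then have dig: "periodic_digit l i n = 0" by (simp add: periodic_digit_def)
    show ?thesis
    proof (intro exI[of _ e'] conjI)
      show "e' < l" using e Suc by simp
      show "(Suc n + e') mod l = i" using e Suc by simp
      have "(q' ^ i / (1 - Q) - (S + of_nat 0 * q' ^ n)) / q' ^ Suc n = q' ^ e' / (1 - Q)"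
        unfolding S' using Suc q0 Q1 by (simp add: field_simps)
      then show "(of_nat q ^ i / (1 - Q) - (\<Sum>k<Suc n. of_nat (periodic_digit l i k) * of_nat q ^ k)) /
          of_nat q ^ Suc n = of_nat q ^ e' / (1 - Q)"
        by (simp add: S_def q'_def dig)
      have "(digit_deriv_value q l i - (T + of_nat 0 * q' ^ n)) / q' ^ Suc n =
          of_nat (Suc n) * q' ^ e' / (1 - Q) + digit_deriv_value q l e'"
      proof -
        define R p where "R = 1 - Q" and "p = q' ^ e'"
        have R: "R \<noteq> 0" and Q: "Q = 1 - R" and p: "q' ^ e = q' * p"
          using Q1 Suc by (auto simp: R_def p_def)
        show ?thesis
          unfolding T' unfolding DD R_def[symmetric] p p_def[symmetric] Q
          using q0 R Suc by (simp add: field_simps power2_eq_square)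
      qed
      then show "(digit_deriv_value q l i - (\<Sum>k<Suc n. of_nat (k * periodic_digit l i k) * of_nat q ^ k)) / of_nat q ^ Suc n =
          of_nat (Suc n) * of_nat q ^ e' / (1 - Q) + digit_deriv_value q l e'"
        by (simp add: T_def q'_def dig)
    qed
  qed
qed

lemma q_digit_periodic:
  assumes "q \<ge> 2" "i < l"
  shows "q_digit q (of_nat q ^ i / (1 - of_nat q ^ l)) = periodic_digit l i"
proof -
  have "q_adic_sums q (periodic_digit l i) (of_nat q ^ i / (1 - of_nat q ^ l))"
    unfolding q_adic_sums_def
  proof
    fix n
    obtain e where "(of_nat q ^ i / (1 - of_nat q ^ l) - (\<Sum>k<n. of_nat (periodic_digit l i k) * of_nat q ^ k)) / of_nat q ^ n
       = of_nat q ^ e / (1 - of_nat q ^ l :: rat)"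
      using periodic_remainder[OF assms, of n] by blast
    moreover have "q_integral q (of_int (int q ^ e) / (1 - of_nat q ^ l) ^ 1)"
      using assms by (intro q_integral_over_one_minus_power) auto
    ultimately show "q_integral q ((of_nat q ^ i / (1 - of_nat q ^ l) -
        (\<Sum>k<n. of_nat (periodic_digit l i k) * of_nat q ^ k)) / of_nat q ^ n)"
      by simp
  qed
  moreover have "\<forall>k. periodic_digit l i k < q" using assms by (simp add: periodic_digit_def)
  ultimately show ?thesis
    unfolding q_digit_def by (intro the_equality) (use q_digits_unique in blast)+
qed

lemma digit_deriv_periodic:
  assumes "q \<ge> 2" "i < l"
  shows "digit_deriv q (of_nat q ^ i / (1 - of_nat q ^ l)) = digit_deriv_value q l i"
proof -
  have "q_adic_sums q (\<lambda>k. k * periodic_digit l i k) (digit_deriv_value q l i)"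
    unfolding q_adic_sums_def
  proof
    fix n
    define R where "R = (1 - of_nat q ^ l :: rat)"
    have R: "R \<noteq> 0"
    proof -
      have "1 < q ^ l" using assms by (intro one_less_power) auto
      then have "(1::rat) < of_nat (q ^ l)" by (metis of_nat_1 of_nat_less_iff)
      then show ?thesis by (simp add: R_def)
    qed
    obtain e where "(digit_deriv_value q l i - (\<Sum>k<n. of_nat (k * periodic_digit l i k) * of_nat q ^ k)) / of_nat q ^ n
       = of_nat n * of_nat q ^ e / R + digit_deriv_value q l e"
      unfolding R_def using periodic_remainder[OF assms, of n] by blast
    also have "\<dots> = (of_nat (n + e) * of_nat q ^ e * R + of_nat l * of_nat q ^ (l + e)) / R ^ 2"
      using R by (simp add: digit_deriv_value_def R_def[symmetric] field_simps power2_eq_square)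
    also have "\<dots> = of_int (int (n + e) * int q ^ e * (1 - int q ^ l) + int l * int q ^ (l + e)) / R ^ 2"
      by (simp add: R_def)
    finally show "q_integral q ((digit_deriv_value q l i -
        (\<Sum>k<n. of_nat (k * periodic_digit l i k) * of_nat q ^ k)) / of_nat q ^ n)"
      unfolding R_def using assms by (simp only: q_integral_over_one_minus_power)
  qed
  then show ?thesis
    unfolding digit_deriv_def q_digit_periodic[OF assms]
    by (intro the_equality) (use q_adic_sums_unique assms in blast)+
qed

section \<open>Absolute values and one-units\<close>

lemma map_poly_to_ac_add: "map_poly to_ac (p + q) = map_poly to_ac p + map_poly to_ac q"
  by (rule poly_eqI) (simp add: coeff_map_poly)

lemma map_poly_to_ac_mult: "map_poly to_ac (p * q) = map_poly to_ac p * map_poly to_ac q"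
  by (rule poly_eqI) (simp add: coeff_map_poly coeff_mult to_ac_sum)

text \<open>Evaluation at \<open>z\<close> is a ring homomorphism into a field, so an annihilating
  polynomial of least degree is irreducible and, by division with remainder, divides all others.
  This gives the description in \<open>ac_minpoly\<close> its unique solution.\<close>

lemma monic_irreducible_root_polynomial:
  fixes z :: "'a::field alg_closure"
  assumes "p \<noteq> 0" "poly (map_poly to_ac p) z = 0"
  shows "monic (ac_minpoly z) \<and> irreducible (ac_minpoly z) \<and>
    (\<forall>p. poly (map_poly to_ac p) z = 0 \<longrightarrow> ac_minpoly z dvd p)"
proof -
  define ev where "ev = (\<lambda>p. poly (map_poly to_ac p) z)"
  have ev_mult: "ev (p * q) = ev p * ev q" and ev_add: "ev (p + q) = ev p + ev q" for p q
    by (simp_all add: ev_def map_poly_to_ac_mult map_poly_to_ac_add)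
  have "\<exists>p. p \<noteq> 0 \<and> ev p = 0" using assms by (auto simp: ev_def)
  from exists_least_iff[of "\<lambda>n. \<exists>p. p \<noteq> 0 \<and> ev p = 0 \<and> degree p = n", THEN iffD1]
  obtain r where r: "r \<noteq> 0" "ev r = 0"
      and least: "\<And>p. p \<noteq> 0 \<Longrightarrow> ev p = 0 \<Longrightarrow> degree r \<le> degree p"
    using assms unfolding ev_def by (metis not_less)
  define m where "m = Polynomial.smult (inverse (lead_coeff r)) r"
  have deg_m: "degree m = degree r" and m0: "m \<noteq> 0" and monic_m: "monic m"
    using r by (auto simp: m_def monic_def)
  have ev_m: "ev m = 0"
    using ev_mult[of "[:inverse (lead_coeff r):]" r] r by (simp add: m_def)
  have dvd: "m dvd p" if "ev p = 0" for p
  proof -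
    have "ev p = ev (p div m) * ev m + ev (p mod m)"
      by (simp flip: ev_mult ev_add)
    then have "ev (p mod m) = 0" using that ev_m by simp
    moreover have "p mod m = 0 \<or> degree (p mod m) < degree m"
      using degree_mod_less[OF m0] by blast
    ultimately have "p mod m = 0" using least deg_m by force
    then show ?thesis by (simp add: dvd_eq_mod_eq_0)
  qed
  have not_unit: "\<not> p dvd 1" if "ev p = 0" for p
  proof
    assume "p dvd 1"
    then obtain k where "1 = p * k" by (elim dvdE)
    then have "ev 1 = 0" using that ev_mult[of p k] by simp
    then show False by (simp add: ev_def)
  qed
  have irr: "irreducible m"
  proof (rule Factorial_Ring.irreducibleI)
    show "m \<noteq> 0" "\<not> m dvd 1" using m0 not_unit ev_m by auto
    fix a b assume ab: "m = a * b"
    then have nz: "a \<noteq> 0" "b \<noteq> 0" using m0 by auto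
    have "ev a = 0 \<or> ev b = 0" using ev_m ab ev_mult by simp
    then have "degree m \<le> degree a \<or> degree m \<le> degree b" using least nz deg_m by auto
    then have "degree a = 0 \<or> degree b = 0" using ab nz by (auto simp: degree_mult_eq)
    then show "a dvd 1 \<or> b dvd 1" using nz by (auto simp: is_unit_iff_degree)
  qed
  have "ac_minpoly z = m"
    unfolding ac_minpoly_def
  proof (rule the_equality)
    show "monic m \<and> irreducible m \<and> poly (map_poly to_ac m) z = 0"
      using monic_m irr ev_m by (simp add: ev_def)
  next
    fix m' assume m': "monic m' \<and> irreducible m' \<and> poly (map_poly to_ac m') z = 0"
    then have "m dvd m'" using dvd by (simp add: ev_def)
    then obtain k where k: "m' = m * k" by (elim dvdE)
    then have "is_unit k" using m' not_unit[OF ev_m] Factorial_Ring.irreducibleD by blast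
    then obtain c where c: "k = [:c:]" by (auto elim: is_unit_polyE)
    have "lead_coeff m' = lead_coeff m * lead_coeff k" by (simp only: k lead_coeff_mult)
    then have "c = 1" using m' monic_m c by (simp add: monic_def)
    then show "m' = m" using k c by (simp add: one_pCons[symmetric])
  qed
  then show ?thesis using monic_m irr dvd by (simp add: ev_def)
qed

lemma card_field_gt_1: "CARD('a::{finite,field}) \<ge> 2"
proof -
  have "card {0, 1 :: 'a} \<le> CARD('a)" by (rule card_mono) auto
  then show ?thesis by simp
qed

lemma ln_card_field_pos: "ln (real CARD('a::{finite,field})) > 0"
  using card_field_gt_1[where 'a = 'a] by simp

lemma ln_kinf_abs:
  fixes x :: "'a::{finite,field} fls"
  assumes "x \<noteq> 0"
  shows "ln (kinf_abs x) = - of_int (fls_subdegree x) * ln (real CARD('a))"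
proof -
  have "real CARD('a) powi (- fls_subdegree x) = real CARD('a) powr of_int (- fls_subdegree x)"
    by (rule powr_real_of_int'[symmetric]) (use card_field_gt_1[where 'a = 'a] in auto)
  then show ?thesis using assms card_field_gt_1[where 'a = 'a]
    by (simp add: kinf_abs_def ln_powr)
qed

lemma kinf_abs_pos: "x \<noteq> 0 \<Longrightarrow> kinf_abs x > 0"
  using card_field_gt_1[where 'a = 'a] by (simp add: kinf_abs_def)

text \<open>
  All conjugates of \<open>z\<close> are \<open>d\<close>-th roots of \<open>v\<close>, so the \<open>d\<close>-th power of the norm of \<open>z\<close> is a power
  of \<open>v\<close> up to sign.
\<close>
lemma ln_cinf_abs_root:
  fixes z :: "'a::{finite,field} fls alg_closure"
  assumes "z ^ d = to_ac v" "d > 0" "v \<noteq> 0"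
  shows "ln (cinf_abs z) = ln (kinf_abs v) / real d"
proof -
  define p where "p = monom 1 d - [:v:]"
  have coeff_p: "coeff p d = 1" using assms(2) by (cases d) (auto simp: p_def)
  have p0: "p \<noteq> 0" using coeff_p by auto
  have map_p: "map_poly to_ac p = monom 1 d - [:to_ac v:]"
    by (rule poly_eqI) (auto simp: p_def coeff_map_poly coeff_pCons split: nat.split)
  have ev_p: "poly (map_poly to_ac p) x = x ^ d - to_ac v" for x
    unfolding map_p by (simp add: poly_monom)
  define m where "m = ac_minpoly z"
  define e where "e = degree m"
  have m: "monic m" "irreducible m" "m dvd p"
    using monic_irreducible_root_polynomial[of p z] p0 ev_p assms(1) by (auto simp: m_def)
  have m0: "m \<noteq> 0" using m by auto
  have e: "e > 0" using irreducible_not_unit[OF m(2)] is_unit_iff_degree[OF m0] by (simp add: e_def)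
  define M where "M = map_poly to_ac m"
  have coeff_M: "coeff M k = to_ac (coeff m k)" for k by (simp add: M_def coeff_map_poly)
  have degM: "degree M = e" unfolding M_def e_def by (rule degree_map_poly) auto
  have leadM: "lead_coeff M = 1" using m(1) by (simp add: degM coeff_M monic_def e_def)
  have "M \<noteq> 0" using leadM by auto
  then obtain A where A: "size A = e" "M = (\<Prod>x\<in>#A. [:-x, 1:])"
    using alg_closed_imp_factorization[of M] degM leadM by auto
  have prod_mset_power: "(\<Prod>x\<in>#A. f x) ^ d = (\<Prod>x\<in>#A. f x ^ d)" for f :: "_ \<Rightarrow> 'a fls alg_closure"
    by (induction A) (simp_all add: power_mult_distrib)
  have root: "(- x) ^ d = to_ac ((-1) ^ d * v)" if "x \<in># A" for x
  proof -
    have "[:-x, 1:] dvd M" unfolding A(2) by (rule dvd_prod_mset) (use that in auto)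
    moreover have "M dvd map_poly to_ac p"
      using m(3) unfolding M_def by (metis dvdE dvdI map_poly_to_ac_mult)
    ultimately have "[:-x, 1:] dvd map_poly to_ac p" by (rule dvd_trans)
    then have "x ^ d = to_ac v" using ev_p by (simp add: poly_eq_0_iff_dvd[symmetric])
    then show ?thesis by (simp add: power_minus[of x])
  qed
  have "to_ac (coeff m 0) = poly M 0" by (simp add: poly_0_coeff_0 coeff_M)
  also have "\<dots> = (\<Prod>x\<in>#A. - x)" unfolding A(2) by (simp add: poly_prod_mset image_mset.compositionality o_def)
  also have "\<dots> ^ d = (\<Prod>x\<in>#A. (- x) ^ d)" by (rule prod_mset_power)
  finally have "to_ac (coeff m 0 ^ d) = (\<Prod>x\<in>#A. (- x) ^ d)" by simp
  also have "\<dots> = (\<Prod>x\<in>#A. to_ac ((-1) ^ d * v))"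
    using root by (intro arg_cong[of _ _ prod_mset] image_mset_cong) auto
  also have "\<dots> = to_ac (((-1) ^ d * v) ^ e)" using A(1) by simp
  finally have eq: "coeff m 0 ^ d = ((-1) ^ d * v) ^ e" by (simp only: to_ac_eq_iff)
  have nz: "coeff m 0 \<noteq> 0"
  proof
    assume "coeff m 0 = 0"
    then have "((-1) ^ d * v) ^ e = 0" using eq assms(2) by (simp add: power_0_left)
    then show False using assms(3) by simp
  qed
  \<comment> \<open>The sign in \<open>eq\<close> does not affect orders. Dividing by
    \<open>e\<close> below matches the root of order \<open>e\<close> in
    \<open>cinf_abs\<close>.\<close>
  have "int d * fls_subdegree (coeff m 0) = int e * fls_subdegree v"
    using arg_cong[OF eq, of fls_subdegree] assms(3) nz
    by (simp add: fls_subdegree_pow fls_uminus_subdegree)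
  then have "real d * of_int (fls_subdegree (coeff m 0)) = real e * of_int (fls_subdegree v)"
    by (metis of_int_mult of_int_of_nat_eq)
  then have "ln (kinf_abs (coeff m 0)) / real e = ln (kinf_abs v) / real d"
    using nz assms e by (simp add: ln_kinf_abs field_simps)
  then show ?thesis
    using e kinf_abs_pos[OF nz] by (simp add: cinf_abs_def m_def[symmetric] e_def[symmetric] ln_root)
qed

text \<open>Congruence to 1 modulo the m-th power of 1/theta. The case x = 1 is listed apart because
  \<open>fls_subdegree 0\<close> is 0, so that the inequality fails there for positive
  \<open>m\<close>.\<close>

definition one_unit :: "int \<Rightarrow> 'a::field fls \<Rightarrow> bool" where
  "one_unit m x \<longleftrightarrow> x = 1 \<or> m \<le> fls_subdegree (x - 1)"

lemma one_unit_iff: "one_unit m x \<longleftrightarrow> (\<forall>k<m. fls_nth x k = fls_nth 1 k)"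
proof
  assume "one_unit m x"
  then show "\<forall>k<m. fls_nth x k = fls_nth 1 k"
    unfolding one_unit_def
    by (metis eq_iff_diff_eq_0 fls_eq0_below_subdegree fls_minus_nth order_less_le_trans)
next
  assume *: "\<forall>k<m. fls_nth x k = fls_nth 1 k"
  show "one_unit m x"
  proof (cases "x = 1")
    case False
    then have "m \<le> fls_subdegree (x - 1)" by (intro fls_subdegree_geI) (use * in auto)
    then show ?thesis by (simp add: one_unit_def)
  qed (simp add: one_unit_def)
qed

lemma one_unit_1 [simp]: "one_unit m 1"
  by (simp add: one_unit_def)

lemma one_unit_mono: "one_unit m x \<Longrightarrow> k \<le> m \<Longrightarrow> one_unit k x"
  by (auto simp: one_unit_def)

lemma one_unit_subdegree:
  assumes "one_unit m x" "m \<ge> 1"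
  shows "fls_subdegree x = 0" "x \<noteq> 0"
proof -
  have "fls_nth x k = fls_nth 1 k" if "k \<le> 0" for k
    using assms that by (simp add: one_unit_iff)
  then show "fls_subdegree x = 0" by (intro fls_subdegree_eqI) auto
  show "x \<noteq> 0" using \<open>\<And>k. k \<le> 0 \<Longrightarrow> _\<close>[of 0] by auto
qed

lemma one_unit_mult:
  assumes "one_unit m x" "one_unit m y" "m \<ge> 0"
  shows "one_unit m (x * y)"
proof (cases "x = 1 \<or> y = 1")
  case False
  then have sub: "m \<le> fls_subdegree (x - 1)" "m \<le> fls_subdegree (y - 1)"
    using assms by (auto simp: one_unit_def)
  have "fls_nth ((x - 1) * (y - 1) + (x - 1) + (y - 1)) k = 0" if "k < m" for k
  proof -
    have "fls_nth ((x - 1) * (y - 1)) k = 0"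
      using sub that assms(3) by (intro fls_times_nth_eq0) auto
    moreover have "fls_nth (x - 1) k = 0" "fls_nth (y - 1) k = 0"
      using sub that by (intro fls_eq0_below_subdegree; simp)+
    ultimately show ?thesis by (simp only: fls_plus_nth add_0)
  qed
  moreover have "(x - 1) * (y - 1) + (x - 1) + (y - 1) = x * y - 1"
    by (simp add: algebra_simps)
  ultimately show ?thesis by (simp add: one_unit_iff)
qed (use assms in auto)

lemma one_unit_prod:
  assumes "\<And>i. i \<in> A \<Longrightarrow> one_unit m (f i)" "m \<ge> 0"
  shows "one_unit m (\<Prod>i\<in>A. f i)"
  using assms by (induction A rule: infinite_finite_induct) (auto intro!: one_unit_mult)

lemma one_unit_inverse:
  assumes "one_unit m x" "m \<ge> 1"
  shows "one_unit m (inverse x)"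
proof (cases "x = 1")
  case False
  have x0: "x \<noteq> 0" using one_unit_subdegree[OF assms] by simp
  have eq: "(inverse x - 1) * x = - (x - 1)" using x0 by (simp add: algebra_simps)
  have "inverse x \<noteq> 1" using False by (metis inverse_1 inverse_inverse_eq)
  then have "fls_subdegree ((inverse x - 1) * x) = fls_subdegree (inverse x - 1)"
    using x0 one_unit_subdegree[OF assms] by (subst fls_subdegree_mult) auto
  then show ?thesis using assms(1) unfolding eq
    by (simp add: one_unit_def fls_subdegree_minus_sym[of x 1])
qed simp

lemma one_unit_power: "one_unit m x \<Longrightarrow> m \<ge> 0 \<Longrightarrow> one_unit m (x ^ n)"
  by (induction n) (auto intro: one_unit_mult)

lemma one_unit_powi: "one_unit m x \<Longrightarrow> m \<ge> 1 \<Longrightarrow> one_unit m (x powi n)"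
  by (auto simp: power_int_def intro!: one_unit_power one_unit_inverse)

lemma one_unit_one_plus: "m \<le> fls_subdegree x \<Longrightarrow> one_unit m (1 + x)"
  by (auto simp: one_unit_def)

text \<open>The metric on Laurent series has base 2 where the absolute value of k_infty has base q;
  both give the same notion of convergence.\<close>

lemma dist_fls_le:
  assumes "\<And>k. k < int n \<Longrightarrow> fls_nth x k = fls_nth y k"
  shows "dist x y \<le> inverse (2 ^ n)"
proof (cases "x = y")
  case False
  then have "int n \<le> fls_subdegree (x - y)" by (intro fls_subdegree_geI) (use assms in auto)
  moreover from this have "(2::real) ^ n \<le> 2 ^ nat (fls_subdegree (x - y))"
    by (intro power_increasing) auto
  ultimately show ?thesis using False by (simp add: dist_fls_def field_simps)
qed simp

text \<open>The first hypothesis freezes coefficient k of the partial products from index k on, so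
  they converge. The second keeps the partial products, and so the limit, one-units; in particular
  the limit is nonzero.\<close>

lemma one_unit_prodinf:
  fixes f :: "nat \<Rightarrow> 'a::field fls"
  assumes f: "\<And>i. one_unit (int i) (f i)" "\<And>i. one_unit 1 (f i)"
  shows "one_unit 1 (prodinf f)"
proof -
  define P where "P n = (\<Prod>i\<le>n. f i)" for n
  have P: "one_unit 1 (P n)" for n unfolding P_def using f(2) by (intro one_unit_prod) auto
  have step: "fls_nth (P (n + j)) k = fls_nth (P n) k" if "k \<le> int n" for n k j
  proof (induction j)
    case (Suc j)
    have eq: "P (n + Suc j) = P (n + j) + P (n + j) * (f (n + Suc j) - 1)"
      by (simp add: P_def algebra_simps)
    have "fls_nth (P (n + j) * (f (n + Suc j) - 1)) k = 0"
    proof (cases "f (n + Suc j) = 1")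
      case False
      then have "int (n + Suc j) \<le> fls_subdegree (f (n + Suc j) - 1)"
        using f(1)[of "n + Suc j"] by (simp add: one_unit_def)
      then show ?thesis
        using that one_unit_subdegree[OF P] by (intro fls_times_nth_eq0) auto
    qed simp
    then show ?case using Suc unfolding eq fls_plus_nth by simp
  qed simp
  \<comment> \<open>Coefficient k is read off the first partial product in which it is final; for
    negative k this is \<open>P 0\<close>, where it is 0.\<close>
  define L where "L = Abs_fls (\<lambda>k. fls_nth (P (nat k)) k)"
  have "fls_nth (P n) k = 0" if "k < 0" for n k
    using P[of n] that by (simp add: one_unit_iff)
  then have L: "fls_nth L k = fls_nth (P (nat k)) k" for k
    unfolding L_def by (intro nth_Abs_fls_lower_bound[of 0]) auto
  have LP: "fls_nth L k = fls_nth (P n) k" if "k \<le> int n" for k n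
    using step[of k "nat k" "n - nat k"] that unfolding L
    by (cases "k \<ge> 0") (use \<open>\<And>n k. k < 0 \<Longrightarrow> fls_nth (P n) k = 0\<close> in auto)
  have L1: "one_unit 1 L" using P[of 0] LP[of _ 0] by (simp add: one_unit_iff)
  have "P \<longlonglongrightarrow> L"
  proof (rule tendsto_dist_iff[THEN iffD2, OF tendsto_sandwich[OF _ _ tendsto_const]])
    show "\<forall>\<^sub>F n in sequentially. 0 \<le> dist (P n) L" by simp
    show "\<forall>\<^sub>F n in sequentially. dist (P n) L \<le> inverse (2 ^ n)"
      by (intro always_eventually allI dist_fls_le LP[symmetric]) simp
    show "(\<lambda>n. inverse (2 ^ n) :: real) \<longlonglongrightarrow> 0" by (rule LIMSEQ_inverse_realpow_zero) simp
  qed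
  moreover have "P = (\<lambda>n. \<Prod>i\<le>n. f (i + 0))" by (simp add: P_def fun_eq_iff)
  ultimately have "f has_prod L"
    using one_unit_subdegree[OF L1] by (simp add: has_prod_def raw_has_prod_def)
  then have "prodinf f = L" by (rule has_prod_unique[symmetric])
  then show ?thesis using L1 by simp
qed

section \<open>Polynomials in theta as elements of k_infty\<close>

lemma at_theta_0 [simp]: "at_theta 0 = 0" by (simp add: at_theta_def)

lemma fls_nth_at_theta: "fls_nth (at_theta f) k = (if k \<le> 0 then coeff f (nat (- k)) else 0)"
proof (induction f arbitrary: k rule: pCons_induct)
  case (pCons a f)
  have "at_theta (pCons a f) = fls_const a + theta * at_theta f"
    using pCons(1) by (cases "f = 0") (auto simp: at_theta_def map_poly_pCons)
  then have "fls_nth (at_theta (pCons a f)) k = (if k = 0 then a else 0) + fls_nth (at_theta f) (k + 1)"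
    by (simp add: fls_X_inv_times_conv_shift)
  also have "\<dots> = (if k \<le> 0 then coeff (pCons a f) (nat (- k)) else 0)"
    unfolding pCons(2) by (auto simp: coeff_pCons nat_diff_distrib split: nat.split
      intro!: arg_cong[of _ _ "coeff f"])
  finally show ?case .
qed simp

lemma at_theta_eq_0_iff [simp]: "at_theta f = 0 \<longleftrightarrow> f = 0"
proof
  assume "at_theta f = 0"
  then have "coeff f n = 0" for n using fls_nth_at_theta[of f "- int n"] by simp
  then show "f = 0" by (simp add: poly_eq_iff)
qed simp

lemma fls_subdegree_at_theta: "fls_subdegree (at_theta f) = - int (degree f)"
proof (cases "f = 0")
  case False
  then show ?thesis
    by (intro fls_subdegree_eqI) (auto simp: fls_nth_at_theta coeff_eq_0)
qed simp

lemma ln_poly_abs: "f \<noteq> 0 \<Longrightarrow> ln (poly_abs (f :: 'a::{finite,field} poly)) = degree f * ln (real CARD('a))"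
  by (simp add: poly_abs_def ln_kinf_abs fls_subdegree_at_theta)

lemma poly_abs_eq: "f \<noteq> 0 \<Longrightarrow> poly_abs (f :: 'a::{finite,field} poly) = real CARD('a) ^ degree f"
  by (simp add: poly_abs_def kinf_abs_def fls_subdegree_at_theta)

lemma one_unit_Pi_ari: "one_unit 1 (Pi_ari y :: 'a::{finite,field} fls)"
  unfolding Pi_ari_def
proof (rule one_unit_prodinf)
  fix i
  define q where "q = CARD('a)"
  have q2: "q \<ge> 2" unfolding q_def by (rule card_field_gt_1)
  have "one_unit (int (max 1 i)) (\<Prod>j<i. 1 - (theta :: 'a fls) ^ (q ^ j) / theta ^ (q ^ i))"
  proof (rule one_unit_prod)
    fix j assume "j \<in> {..<i}"
    then have j: "j < i" by simp
    \<comment> \<open>The subtracted term has order q^i - q^j, to be bounded below by max 1 i, which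
      serves both hypotheses of \<open>one_unit_prodinf\<close>. Now q^i is at least 2 q^(i-1),
      where one copy of q^(i-1) dominates q^j and the other is at least i.\<close>
    have "j + 1 \<le> i" using j by simp
    then have "q ^ (j + 1) \<le> q ^ i" by (rule power_increasing) (use q2 in auto)
    moreover have "2 * q ^ j \<le> q ^ (j + 1)" using q2 by simp
    moreover have "2 * q ^ (i - 1) \<le> q ^ i" using q2 j by (cases i) auto
    moreover have "i - 1 < 2 ^ (i - 1)" by (rule less_exp)
    moreover have "2 ^ (i - 1) \<le> q ^ (i - 1)" by (rule power_mono) (use q2 in auto)
    moreover have "q ^ j \<le> q ^ (i - 1)" by (rule power_increasing) (use q2 j in auto)
    ultimately have le: "max 1 i + q ^ j \<le> q ^ i" using j by linarith
    have "fls_subdegree ((theta :: 'a fls) ^ (q ^ j) / theta ^ (q ^ i)) = int (q ^ i) - int (q ^ j)"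
      by (subst fls_divide_subdegree) (simp_all add: fls_subdegree_pow)
    then have "int (max 1 i) \<le> fls_subdegree (- ((theta :: 'a fls) ^ (q ^ j) / theta ^ (q ^ i)))"
      using le by (simp only: fls_uminus_subdegree)
    then show "one_unit (int (max 1 i)) (1 - (theta :: 'a fls) ^ (q ^ j) / theta ^ (q ^ i))"
      using one_unit_one_plus by fastforce
  qed simp
  then have "one_unit (int (max 1 i)) ((\<Prod>j<i. 1 - (theta :: 'a fls) ^ (q ^ j) / theta ^ (q ^ i)) ^ q_digit q y i)"
    by (rule one_unit_power) simp
  then show "one_unit (int i) ((\<Prod>j<i. 1 - (theta :: 'a fls) ^ (CARD('a) ^ j) / theta ^ (CARD('a) ^ i)) ^ q_digit CARD('a) y i)"
    "one_unit 1 ((\<Prod>j<i. 1 - (theta :: 'a fls) ^ (CARD('a) ^ j) / theta ^ (CARD('a) ^ i)) ^ q_digit CARD('a) y i)"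
    unfolding q_def by (auto elim!: one_unit_mono)
qed

text \<open>The argument will be a quotient whose numerator has smaller degree than its denominator.
  Dividing it by a polynomial of degree i gives order at least i + 1, so every factor is a one-unit
  and may be inverted.\<close>

lemma one_unit_Pi_geo:
  fixes x :: "'a::{finite,field} fls"
  assumes "fls_subdegree x \<ge> 1"
  shows "one_unit 1 (Pi_geo x y)"
  unfolding Pi_geo_def
proof (rule one_unit_prodinf)
  fix i
  have "one_unit (int (Suc i)) (\<Prod>a | monic a \<and> degree a = i.
      (1 + x / at_theta a) powi (- int (q_digit CARD('a) y i)))"
  proof (intro one_unit_prod one_unit_powi one_unit_one_plus)
    fix a :: "'a poly" assume a: "a \<in> {a. monic a \<and> degree a = i}"
    then have a0: "at_theta a \<noteq> 0" by (auto simp: monic_def)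
    have "x \<noteq> 0" using assms by auto
    then show "int (Suc i) \<le> fls_subdegree (x / at_theta a)"
      using a a0 assms by (subst fls_divide_subdegree) (auto simp: fls_subdegree_at_theta)
  qed auto
  then show "one_unit (int i) (\<Prod>a | monic a \<and> degree a = i.
      (1 + x / at_theta a) powi (- int (q_digit CARD('a) y i)))"
    "one_unit 1 (\<Prod>a | monic a \<and> degree a = i.
      (1 + x / at_theta a) powi (- int (q_digit CARD('a) y i)))"
    by (auto elim!: one_unit_mono)
qed

section \<open>Absolute values of the gamma values\<close>

text \<open>The d-th power of the quotient, with d the denominator of \<open>r\<close>, lies in
  k_infty whichever root \<open>theta_rpow\<close> has chosen, so that
  \<open>ln_cinf_abs_root\<close> applies.\<close>

lemma ln_cinf_abs_quotient:
  fixes u B :: "'a::{finite,field} fls"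
  assumes "u \<noteq> 0" "B \<noteq> 0"
  shows "ln (cinf_abs (to_ac u / (theta_rpow r * to_ac B))) =
    ln (kinf_abs u) - ln (kinf_abs B) - of_rat r * ln (real CARD('a))"
proof -
  obtain m d where md: "quotient_of r = (m, d)" by (cases "quotient_of r")
  have d: "d > 0" and r: "r = of_int m / of_int d"
    using quotient_of_denom_pos[OF md] quotient_of_div[OF md] by auto
  define w where "w = (theta_rpow r :: 'a fls alg_closure)"
  have w: "w ^ nat d = to_ac (theta powi m)"
    unfolding w_def theta_rpow_def md fst_conv snd_conv
    by (rule someI_ex, rule nth_root_exists) (use d in simp)
  define v where "v = (u / B) ^ nat d / theta powi m"
  have v: "(to_ac u / (w * to_ac B)) ^ nat d = to_ac v"
    by (simp add: v_def power_divide power_mult_distrib w field_simps)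
  have v0: "v \<noteq> 0" using assms by (simp add: v_def)
  have uB: "u / B \<noteq> 0" using assms by simp
  have "fls_subdegree v = int (nat d) * (fls_subdegree u - fls_subdegree B) + m"
    unfolding v_def using assms uB
    by (subst fls_divide_subdegree) (simp_all add: fls_subdegree_pow fls_divide_subdegree)
  then have "ln (kinf_abs v) = - (of_int d * of_int (fls_subdegree u - fls_subdegree B) + of_int m) * ln (real CARD('a))"
    using d by (simp add: ln_kinf_abs[OF v0])
  moreover have "ln (cinf_abs (to_ac u / (w * to_ac B))) = ln (kinf_abs v) / real (nat d)"
    by (rule ln_cinf_abs_root[OF v]) (use d v0 in auto)
  moreover have "- (of_int d * s + of_int m) * t / real (nat d) = - s * t - of_int m / of_int d * t" for s t
    using d by (simp add: field_simps)
  ultimately show ?thesis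
    using assms unfolding w_def[symmetric]
    by (simp add: r of_rat_divide ln_kinf_abs left_diff_distrib)
qed

lemma of_rat_digit_deriv_value: "of_rat (digit_deriv_value q l i) = digit_deriv_value q l i"
  by (simp add: digit_deriv_value_def of_rat_add of_rat_divide of_rat_mult of_rat_power of_rat_diff)

text \<open>One-units have absolute value 1, so only the powers of \<open>x\<close> and theta
  remain. At x = 0 the pairing is multiplied by \<open>fls_subdegree 0 = 0\<close>, so the formula
  also covers the separate branch of \<open>Gamma_star\<close>.\<close>

lemma ln_cinf_abs_Gamma_star:
  fixes x :: "'a::{finite,field} fls"
  assumes x: "x = 0 \<or> fls_subdegree x \<ge> 1" and i: "i < l"
  shows "ln (cinf_abs (Gamma_star l i x)) =
    (real (pairing l i x) * of_int (fls_subdegree x) - digit_deriv_value CARD('a) l i) * ln (real CARD('a))"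
proof -
  \<comment> \<open>This is the gamma argument already shifted by 1, with the sign turned so that
    its digits are periodic.\<close>
  define y :: rat where "y = of_nat CARD('a) ^ i / (1 - of_nat CARD('a) ^ l)"
  have y: "1 - of_nat CARD('a) ^ i / (of_nat CARD('a) ^ l - 1) - 1 = y"
    unfolding y_def by (metis diff_diff_eq2 add_diff_cancel_left' diff_add_cancel diff_eq_eq minus_diff_eq minus_divide_right uminus_add_conv_diff)
  define B where "B = (Pi_ari y :: 'a fls)"
  have B: "fls_subdegree B = 0" "B \<noteq> 0"
    unfolding B_def using one_unit_subdegree[OF one_unit_Pi_ari] by auto
  define u where "u = (if x = 0 then 1 else x powi (- int (pairing l i x)) * Pi_geo x y)"
  have G: "Gamma_star l i x = to_ac u / (theta_rpow (digit_deriv_value CARD('a) l i) * to_ac B)"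
    unfolding Gamma_star_def Gamma_ari_star_def Gamma_ari_def Let_def y
    using digit_deriv_periodic[OF card_field_gt_1[where 'a = 'a] i]
    by (simp add: y_def[symmetric] B_def u_def field_simps)
  have u: "u \<noteq> 0" "fls_subdegree u = - int (pairing l i x) * fls_subdegree x"
    using one_unit_subdegree[OF one_unit_Pi_geo[of x y]] x by (auto simp: u_def)
  show ?thesis
    unfolding G ln_cinf_abs_quotient[OF u(1) B(2)] of_rat_digit_deriv_value
    using B u by (simp add: ln_kinf_abs algebra_simps)
qed

text \<open>With s = deg c - deg a, the expansion of a/c in 1/theta starts at index s with the
  leading coefficient of \<open>a\<close>. So only N = s - 1 can have a nonzero bracket, and it is
  congruent to -1 - i modulo \<open>l\<close> exactly when i + deg c is congruent to deg a.\<close>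

lemma pairing_at_theta:
  fixes a c :: "'a::{finite,field} poly"
  assumes "monic c" "a \<noteq> 0" "degree a < degree c"
  shows "pairing l i (at_theta a / at_theta c) =
    (if monic a \<and> (i + degree c) mod l = degree a mod l then 1 else 0)"
proof -
  have c0: "c \<noteq> 0" using assms(1) by (auto simp: monic_def)
  define x where "x = at_theta a / at_theta c"
  define s where "s = degree c - degree a"
  have s: "s \<ge> 1" using assms(3) by (simp add: s_def)
  have x0: "x \<noteq> 0" using assms c0 by (simp add: x_def)
  have sub: "fls_subdegree x = int s"
    unfolding x_def s_def using assms c0
    by (subst fls_divide_subdegree) (auto simp: fls_subdegree_at_theta)
  have base: "fls_nth x (int s) = lead_coeff a"
  proof -
    have "fls_nth (x * at_theta c) (fls_subdegree x + fls_subdegree (at_theta c)) =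
        fls_nth x (int s) * lead_coeff c"
      by (subst fls_times_base) (simp add: sub fls_subdegree_at_theta fls_nth_at_theta)
    moreover have "x * at_theta c = at_theta a" using c0 by (simp add: x_def)
    moreover have "fls_subdegree x + fls_subdegree (at_theta c) = - int (degree a)"
      using assms(3) by (simp add: sub fls_subdegree_at_theta s_def)
    ultimately show ?thesis using assms(1) by (simp add: fls_nth_at_theta monic_def)
  qed
  have bracket: "bracket x N = (if N = s - 1 \<and> monic a then 1 else 0)" for N
  proof -
    have "(\<forall>i. 0 < i \<and> i < int N + 1 \<longrightarrow> fls_nth x i = 0) \<and> fls_nth x (int N + 1) = 1
        \<longleftrightarrow> N = s - 1 \<and> monic a" (is "?P \<longleftrightarrow> ?Q")
    proof
      assume P: ?P
      have "fls_nth x k = 0" if "k < int N + 1" for k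
        using P that sub s by (cases "k > 0") auto
      then have "fls_subdegree x = int N + 1" using P by (intro fls_subdegree_eqI) auto
      then show ?Q using sub P base by (auto simp: monic_def)
    next
      assume Q: ?Q
      then have "int N + 1 = int s" using s by simp
      then show ?P using Q base sub by (auto simp: monic_def)
    qed
    then show ?thesis by (simp add: bracket_def)
  qed
  have "int (s - 1) mod int l = (- 1 - int i) mod int l \<longleftrightarrow>
      int (i + degree c) mod int l = int (degree a) mod int l"
  proof -
    have "int (s - 1) - (- 1 - int i) = int (i + degree c) - int (degree a)"
      using assms(3) s by (simp add: s_def of_nat_diff)
    then show ?thesis by (simp only: mod_eq_dvd_iff)
  qed
  then have iff: "int (s - 1) mod int l = (- 1 - int i) mod int l \<longleftrightarrow>
      (i + degree c) mod l = degree a mod l"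
    by (metis of_nat_eq_iff zmod_int)
  have "{N. int N mod int l = (- 1 - int i) mod int l \<and> bracket x N \<noteq> 0} =
      (if monic a \<and> (i + degree c) mod l = degree a mod l then {s - 1} else {})"
    using iff by (auto simp: bracket)
  then show ?thesis
    unfolding x_def[symmetric] pairing_def by (simp add: bracket)
qed

section \<open>Characters and conductors\<close>

locale G_character =
  fixes n :: "'a::{finite,field} poly" and l :: nat and chi :: "'a poly \<times> int \<Rightarrow> complex"
  assumes monic_n: "monic n" and l_pos: "l \<ge> 1" and chi_char: "chi \<in> G_characters n l"
begin

lemma n_nonzero [simp]: "n \<noteq> 0"
  using monic_n by (rule monic_nonzero)

lemma chi_mult:
  assumes "coprime a n" "coprime b n"
  shows "chi ((a * b) mod n, (i + j) mod int l) = chi (a mod n, i mod int l) * chi (b mod n, j mod int l)"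
proof -
  have carrier: "(a mod n, i mod int l) \<in> carrier (G_group n l)" if "coprime a n" for a i
    using that l_pos by (simp add: G_group_def poly_unit_group_def carrier_integer_mod_group)
  have "chi ((a mod n, i mod int l) \<otimes>\<^bsub>G_group n l\<^esub> (b mod n, j mod int l)) =
      chi (a mod n, i mod int l) \<otimes>\<^bsub>complex_units\<^esub> chi (b mod n, j mod int l)"
    using chi_char carrier assms unfolding G_characters_def by (intro hom_mult) auto
  then show ?thesis
    by (simp add: G_group_def poly_unit_group_def complex_units_def mod_mult_eq mod_add_eq)
qed

lemma chi_nonzero: "coprime a n \<Longrightarrow> chi (a mod n, i mod int l) \<noteq> 0"
proof -
  assume "coprime a n"
  then have "(a mod n, i mod int l) \<in> carrier (G_group n l)"
    using l_pos by (simp add: G_group_def poly_unit_group_def carrier_integer_mod_group)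
  then have "chi (a mod n, i mod int l) \<in> carrier complex_units"
    using chi_char unfolding G_characters_def by (rule hom_in_carrier[rotated])
  then show ?thesis by (simp add: complex_units_def)
qed

text \<open>\<open>psi\<close> and \<open>om\<close> describe \<open>chi\<close> on the two factors
  of the group. Only at polynomials prime to \<open>n\<close> is the value of \<open>psi\<close>
  controlled.\<close>

definition psi :: "'a poly \<Rightarrow> complex" where "psi b = chi (b mod n, 0)"

definition om :: complex where "om = chi (1 mod n, 1 mod int l)"

lemma psi_mult: "coprime a n \<Longrightarrow> coprime b n \<Longrightarrow> psi (a * b) = psi a * psi b"
  using chi_mult[of a b 0 0] by (simp add: psi_def)

lemma psi_nonzero: "coprime a n \<Longrightarrow> psi a \<noteq> 0"
  using chi_nonzero[of a 0] by (simp add: psi_def)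

lemma psi_1: "psi 1 = 1"
  using psi_mult[of 1 1] psi_nonzero[of 1] by simp

lemma chi_eq: "coprime b n \<Longrightarrow> chi (b mod n, int m mod int l) = psi b * om ^ m"
proof (induction m)
  case (Suc m)
  have "chi ((b * 1) mod n, (int m + 1) mod int l) = chi (b mod n, int m mod int l) * om"
    unfolding om_def using Suc.prems by (intro chi_mult) auto
  then show ?case using Suc by (simp add: add.commute)
qed (simp add: psi_def)

lemma om_power_l: "om ^ l = 1"
  using chi_eq[of 1 l] by (simp add: psi_1 psi_def[symmetric])

lemma norm_om: "norm om = 1"
proof -
  have "norm om ^ l = 1" by (simp add: om_power_l flip: norm_power)
  then show ?thesis using l_pos power_eq_imp_eq_base[of "norm om" l 1] by simp
qed

text \<open>The powers of \<open>psi b\<close> are values of \<open>psi\<close> at reduced residues,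
  a finite set, whereas a norm above 1 would make them unbounded.\<close>

lemma norm_psi_le: "coprime b n \<Longrightarrow> norm (psi b) \<le> 1"
proof (rule ccontr)
  assume b: "coprime b n" and "\<not> norm (psi b) \<le> 1"
  then have gt: "1 < norm (psi b)" by simp
  have pow: "coprime (b ^ k) n \<and> psi (b ^ k) = psi b ^ k" for k
    using b by (induction k) (simp_all add: psi_1 poly_coprime_mult_left psi_mult)
  have "finite (psi ` polys_below (degree n))"
    using finite_card_polys_below[of "degree n", where 'a = 'a] by simp
  then obtain B where B: "\<And>x. x \<in> psi ` polys_below (degree n) \<Longrightarrow> norm x \<le> B"
    using finite_imp_bounded bounded_iff by metis
  have "norm (psi b) ^ k \<le> B" for k
  proof -
    have "psi b ^ k = psi (b ^ k mod n)" using pow[of k] by (simp add: psi_def)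
    then show ?thesis using B mod_in_polys_below[OF n_nonzero] by (metis imageI norm_power)
  qed
  moreover obtain k where "B < norm (psi b) ^ k" using real_arch_pow[OF gt] by blast
  ultimately show False by (meson not_less)
qed

text \<open>Multiplying by an inverse of \<open>b\<close> modulo \<open>n\<close> reduces to residue
  1, the case in the definition of \<open>modulus_of\<close>.\<close>

lemma psi_cong:
  assumes d: "modulus_of n chi d" and ab: "coprime a n" "coprime b n" "a mod d = b mod d"
  shows "psi a = psi b"
proof -
  obtain b' where b': "coprime b' n" "(b * b') mod n = 1 mod n" using poly_inverse_mod ab(2) by blast
  have dn: "d dvd n" using d by (simp add: modulus_of_def)
  have "(b * b') mod d = 1 mod d"
    using b'(2) dn by (metis mod_mod_cancel)
  then have "(a * b') mod d = 1 mod d" using ab(3) by (metis mod_mult_left_eq)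
  then have "psi (a * b') = 1"
    using d ab b' by (simp add: modulus_of_def psi_def poly_coprime_mult_left)
  moreover have "psi (b * b') = 1" using b'(2) psi_1 by (simp add: psi_def)
  ultimately have "psi a * psi b' = psi b * psi b'" using ab b' by (simp add: psi_mult)
  then show ?thesis using psi_nonzero[OF b'(1)] by simp
qed

text \<open>
  If \<open>a = 1\<close> modulo a common divisor of \<open>d\<close> and \<open>e\<close> of the form \<open>d x + e y\<close>, some \<open>b\<close> prime to \<open>n\<close>
  is congruent to \<open>1\<close> modulo \<open>d\<close> and to \<open>a\<close> modulo \<open>e\<close>, so that \<open>psi a = psi b = 1\<close>.
\<close>
lemma modulus_of_gcd:
  assumes d: "modulus_of n chi d" and e: "modulus_of n chi e"
    and g: "monic g" "g = d * x + e * y" "g dvd d"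
  shows "modulus_of n chi g"
  unfolding modulus_of_def
proof (intro conjI allI impI)
  show "monic g" by fact
  have dn: "d dvd n" and en: "e dvd n" using d e by (simp_all add: modulus_of_def)
  show "g dvd n" using g(3) dn by (rule dvd_trans)
  fix a assume a: "coprime a n" "a mod g = 1 mod g"
  then obtain w where w: "a - 1 = g * w" by (auto simp: mod_eq_dvd_iff elim: dvdE)
  define b where "b = 1 + d * (x * w)"
  have b_d: "b mod d = 1 mod d" by (simp add: b_def)
  have "a = 1 + (d * x + e * y) * w" using w g(2) by (simp add: algebra_simps)
  then have "a = b + e * (y * w)" by (simp add: b_def algebra_simps)
  then have b_e: "b mod e = a mod e" by simp
  obtain k where k: "n = d * k" using dn by (elim dvdE)
  have "coprime b d" using poly_coprime_cong[OF b_d] by simp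
  moreover have "coprime b e"
    using poly_coprime_cong[OF b_e] a(1) en by (meson coprime_divisors dvd_refl)
  ultimately have "coprime b (d * e)"
    using poly_coprime_mult_left[of d e b] by (simp add: coprime_commute)
  \<comment> \<open>\<open>b\<close> is prime to \<open>d * e\<close> but perhaps not to
    \<open>n\<close>. As \<open>d * e\<close> need not divide \<open>n\<close>, the lift is taken
    relative to \<open>d * e * n\<close>.\<close>
  then obtain b' where b': "coprime b' (d * e * n)" "b' mod (d * e) = b mod (d * e)"
    by (rule lift_coprime[of b "d * e" "d * e * n"]) (use n_nonzero dn en in auto)
  have cop: "coprime b' n" using b'(1) by (meson coprime_divisors dvd_refl dvd_triv_right)
  have "b' mod d = 1 mod d" "b' mod e = a mod e"
    using b'(2) b_d b_e by (metis dvd_triv_left mod_mod_cancel, metis dvd_triv_right mod_mod_cancel)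
  then have "psi b' = 1" "psi b' = psi a"
    using psi_cong[OF d cop, of 1] psi_cong[OF e cop a(1)] psi_1 by simp_all
  then show "chi (a mod n, 0) = 1" by (simp add: psi_def)
qed

section \<open>The conductor and the primitive character\<close>

definition cond :: "'a poly" where "cond = conductor n chi"

text \<open>Let c be a modulus of least degree. For any modulus d, the gcd of c and d is again a
  modulus by \<open>modulus_of_gcd\<close>, and minimality identifies it with c; hence c divides
  d.\<close>

lemma modulus_of_conductor: "modulus_of n chi cond"
  and conductor_dvd: "modulus_of n chi d \<Longrightarrow> cond dvd d"
proof -
  have n: "modulus_of n chi n" using monic_n psi_1 by (simp add: modulus_of_def psi_def)
  then have "\<exists>d. modulus_of n chi d" ..
  from ex_has_least_nat[of "modulus_of n chi" _ degree] this
  obtain c where c: "modulus_of n chi c" and least: "\<And>d. modulus_of n chi d \<Longrightarrow> degree c \<le> degree d"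
    by blast
  have monic: "monic d" if "modulus_of n chi d" for d using that by (simp add: modulus_of_def)
  have dvd: "c dvd d" if d: "modulus_of n chi d" for d
  proof -
    obtain g x y where g: "monic g" "g = c * x + d * y" "g dvd c" "g dvd d"
      using poly_bezout[of c d] monic_nonzero[OF monic[OF c]] by metis
    then have "modulus_of n chi g" using modulus_of_gcd[OF c d] by blast
    then have "g = c" using monic_dvd_antisym[OF g(1) monic[OF c] g(3)] least by blast
    then show ?thesis using g(4) by simp
  qed
  have "cond = c"
    unfolding cond_def conductor_def
  proof (rule the_equality)
    fix c' assume c': "modulus_of n chi c' \<and> (\<forall>d. modulus_of n chi d \<longrightarrow> c' dvd d)"
    then have "c' dvd c" using c by blast
    then show "c' = c" using c' c monic least by (intro monic_dvd_antisym) auto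
  qed (use c dvd in blast)
  then show "modulus_of n chi cond" "modulus_of n chi d \<Longrightarrow> cond dvd d" using c dvd by auto
qed

lemma monic_cond: "monic cond" and cond_dvd: "cond dvd n"
  using modulus_of_conductor by (simp_all add: modulus_of_def)

lemma cond_nonzero [simp]: "cond \<noteq> 0"
  using monic_cond by (rule monic_nonzero)

text \<open>The Dirichlet character modulo the conductor, extended by zero so that it is
  multiplicative and periodic on all polynomials. The chosen lift does not matter
  (\<open>F_eq_psi\<close>).\<close>

definition F :: "'a poly \<Rightarrow> complex" where
  "F a = (if coprime a cond then psi (SOME b. coprime b n \<and> b mod cond = a mod cond) else 0)"

lemma F_eq_psi:
  assumes "coprime b n" "b mod cond = a mod cond"
  shows "F a = psi b"
proof -
  let ?b = "SOME b. coprime b n \<and> b mod cond = a mod cond"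
  have "coprime ?b n \<and> ?b mod cond = a mod cond" by (rule someI[of _ b]) (use assms in auto)
  then have "psi ?b = psi b" using assms by (intro psi_cong[OF modulus_of_conductor]) auto
  moreover have "coprime b cond" using assms(1) cond_dvd by (meson coprime_divisors dvd_refl)
  then have "coprime a cond" using poly_coprime_cong[OF assms(2)] by simp
  ultimately show ?thesis by (simp add: F_def)
qed

lemma coprime_cond_lift:
  assumes "coprime a cond"
  obtains b where "coprime b n" "b mod cond = a mod cond" "F a = psi b"
  using lift_coprime[OF assms cond_dvd n_nonzero] F_eq_psi by metis

lemma prim_char_eq:
  assumes "coprime a cond"
  shows "prim_char n l chi a m = F a * om ^ m"
proof -
  obtain b where b: "coprime b n" "b mod cond = a mod cond" "F a = psi b"
    using assms by (rule coprime_cond_lift)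
  show ?thesis
    unfolding prim_char_def cond_def[symmetric]
  proof (rule the_equality)
    show "\<exists>b. coprime b n \<and> b mod cond = a mod cond \<and> F a * om ^ m = chi (b mod n, int m mod int l)"
      using b chi_eq by metis
  next
    fix v assume "\<exists>b. coprime b n \<and> b mod cond = a mod cond \<and> v = chi (b mod n, int m mod int l)"
    then show "v = F a * om ^ m" using chi_eq F_eq_psi by metis
  qed
qed

lemma F_not_coprime: "\<not> coprime a cond \<Longrightarrow> F a = 0"
  by (simp add: F_def)

lemma F_mod: "F (a mod cond) = F a"
proof (cases "coprime a cond")
  case True
  then obtain b where "coprime b n" "b mod cond = a mod cond" "F a = psi b"
    by (rule coprime_cond_lift)
  then show ?thesis using F_eq_psi[of b "a mod cond"] by simp
qed (simp add: F_def)

lemma F_1: "F 1 = 1"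
  using F_eq_psi[of 1 1] psi_1 by simp

lemma F_mult: "F (a * b) = F a * F b"
proof (cases "coprime a cond \<and> coprime b cond")
  case True
  obtain a' where a': "coprime a' n" "a' mod cond = a mod cond" "F a = psi a'"
    using True coprime_cond_lift by blast
  obtain b' where b': "coprime b' n" "b' mod cond = b mod cond" "F b = psi b'"
    using True coprime_cond_lift by blast
  have "F (a * b) = psi (a' * b')"
  proof (rule F_eq_psi)
    show "coprime (a' * b') n" using a' b' by (simp add: poly_coprime_mult_left)
    show "(a' * b') mod cond = (a * b) mod cond" using a'(2) b'(2) by (rule mod_mult_cong)
  qed
  then show ?thesis using a' b' by (simp add: psi_mult)
next
  case False
  then show ?thesis by (auto simp: F_def poly_coprime_mult_left)
qed

lemma norm_F_le: "norm (F a) \<le> 1"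
proof (cases "coprime a cond")
  case True
  then show ?thesis using norm_psi_le coprime_cond_lift by metis
qed (simp add: F_not_coprime)

lemma F_cond_1:
  assumes "degree cond = 0"
  shows "cond = 1" "F a = 1"
proof -
  show c: "cond = 1" using monic_degree_0[OF monic_cond assms] .
  show "F a = 1" using F_mod[of a] F_mod[of 1] F_1 by (simp add: c)
qed

text \<open>As 1 is not a modulus, psi b differs from 1 for some b prime to \<open>n\<close>.
  Multiplication by b permutes the residues and multiplies the sum by psi b.\<close>

lemma sum_F_eq_0:
  assumes "degree cond > 0"
  shows "sum F (polys_below (degree cond)) = 0"
proof -
  have "\<not> modulus_of n chi 1"
    using conductor_dvd[of 1] assms by (auto simp: is_unit_iff_degree)
  then obtain b where b: "coprime b n" "psi b \<noteq> 1" by (auto simp: modulus_of_def psi_def)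
  have Fb: "F b = psi b" using b(1) by (intro F_eq_psi) auto
  obtain b' where b': "(b * b') mod cond = 1 mod cond"
    using poly_inverse_mod[of b cond] b(1) cond_dvd by (meson coprime_divisors dvd_refl)
  have inv: "(b' * (b * r mod cond)) mod cond = r" "(b * (b' * r mod cond)) mod cond = r"
    if "r \<in> polys_below (degree cond)" for r
  proof -
    have "(b * b' * r) mod cond = r mod cond" using b' by (metis mod_mult_left_eq mult_1)
    then show "(b' * (b * r mod cond)) mod cond = r" "(b * (b' * r mod cond)) mod cond = r"
      using mod_polys_below[OF that] by (simp_all add: mod_mult_right_eq mult.assoc mult.left_commute)
  qed
  have "sum F (polys_below (degree cond)) = (\<Sum>r\<in>polys_below (degree cond). F b * F r)"
  proof (rule sum.reindex_bij_witness[where i = "\<lambda>r. (b * r) mod cond" and j = "\<lambda>r. (b' * r) mod cond"])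
    fix r :: "'a poly" assume r: "r \<in> polys_below (degree cond)"
    show "(b * (b' * r mod cond)) mod cond = r" "(b' * (b * r mod cond)) mod cond = r"
      using inv[OF r] by simp_all
    show "(b' * r) mod cond \<in> polys_below (degree cond)" "(b * r) mod cond \<in> polys_below (degree cond)"
      by (simp_all add: mod_in_polys_below)
    have "F b * F ((b' * r) mod cond) = F ((b * (b' * r mod cond)) mod cond)"
      by (simp only: F_mult F_mod)
    then show "F b * F ((b' * r) mod cond) = F r" by (simp only: inv(2)[OF r])
  qed
  also have "\<dots> = psi b * sum F (polys_below (degree cond))"
    by (simp add: Fb sum_distrib_left)
  finally have "sum F (polys_below (degree cond)) = psi b * sum F (polys_below (degree cond))" .
  then show ?thesis using b(2) by simp
qed

lemma sum_F_monics:
  "degree cond > 0 \<Longrightarrow> d \<ge> degree cond \<Longrightarrow> sum F (monics d) = 0"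
  "degree cond = 0 \<Longrightarrow> sum F (monics d) = of_nat (CARD('a) ^ d)"
  using sum_monics_periodic[of cond d F] sum_F_eq_0 monic_cond F_mod
  by (simp_all add: F_cond_1 card_monics)

end

section \<open>Euler products\<close>

lemma monic_irreducible_dvd_eq:
  fixes p r :: "'a::field poly"
  assumes "monic p" "irreducible p" "monic r" "irreducible r" "r dvd p"
  shows "r = p"
proof -
  obtain k where k: "p = r * k" using assms(5) by (elim dvdE)
  then have "is_unit k"
    using assms Factorial_Ring.irreducibleD irreducible_not_unit by blast
  then have "degree p \<le> degree r"
    using k assms(1) by (auto simp: is_unit_poly_iff degree_mult_le dest: monic_nonzero)
  then show ?thesis using assms by (intro monic_dvd_antisym)
qed

definition irreducible_monics :: "nat \<Rightarrow> 'a::field poly set" where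
  "irreducible_monics d = {p. monic p \<and> irreducible p \<and> degree p = d}"

lemma finite_irreducible_monics [simp]: "finite (irreducible_monics d :: 'a::{finite,field} poly set)"
  by (rule finite_subset[OF _ finite_monics[of d]]) (auto simp: irreducible_monics_def monics_def)

text \<open>Applied with z = om q^(-s) and Re s > 1. There are q^d monic polynomials of degree d, so
  \<open>z_small\<close> makes the sum over all of them converge by comparison with a geometric
  series.\<close>

locale bounded_multiplicative =
  fixes F :: "'a::{finite,field} poly \<Rightarrow> complex" and z :: complex
  assumes F_mult: "F (a * b) = F a * F b" and F_1: "F 1 = 1" and norm_F: "norm (F a) \<le> 1"
    and z_small: "real CARD('a) * norm z < 1"
begin

definition g :: "'a poly \<Rightarrow> complex" where "g a = F a * z ^ degree a"

definition r :: real where "r = real CARD('a) * norm z"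

definition L :: complex where "L = infsum g {a. monic a}"

lemma r_bounds: "0 \<le> r" "r < 1"
  using z_small by (simp_all add: r_def)

lemma norm_g: "norm (g a) \<le> norm z ^ degree a"
  using mult_right_mono[OF norm_F[of a], of "norm z ^ degree a"]
  by (simp add: g_def norm_mult norm_power)

lemma g_mult: "a \<noteq> 0 \<Longrightarrow> b \<noteq> 0 \<Longrightarrow> g (a * b) = g a * g b"
  by (simp add: g_def F_mult degree_mult_eq power_add)

text \<open>This bound gives summability at N = 0, and for general \<open>N\<close> the error terms
  of the expansion by degree and of the sieve.\<close>

lemma sum_norm_le:
  assumes "finite Y" "Y \<subseteq> {a. monic a \<and> N \<le> degree a}"
  shows "(\<Sum>a\<in>Y. norm (g a)) \<le> r ^ N / (1 - r)"
proof -
  obtain K where K: "\<And>a. a \<in> Y \<Longrightarrow> degree a \<le> K"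
    using finite_nat_set_iff_bounded_le[of "degree ` Y"] assms(1) by auto
  have "(\<Sum>a\<in>Y. norm (g a)) \<le> (\<Sum>a\<in>Y. norm z ^ degree a)"
    by (rule sum_mono) (rule norm_g)
  also have "\<dots> \<le> (\<Sum>a\<in>(\<Union>d\<in>{N..K}. monics d :: 'a poly set). norm z ^ degree a)"
  proof (rule sum_mono2)
    show "Y \<subseteq> (\<Union>d\<in>{N..K}. monics d)" using assms(2) K by (auto simp: monics_def)
  qed auto
  also have "\<dots> = (\<Sum>d\<in>{N..K}. \<Sum>a\<in>(monics d :: 'a poly set). norm z ^ degree a)"
    by (rule sum.UNION_disjoint) (auto, auto simp: monics_def)
  also have "\<dots> = (\<Sum>d\<in>{N..K}. r ^ d)"
  proof (rule sum.cong[OF refl])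
    fix d
    have "(\<Sum>a\<in>(monics d :: 'a poly set). norm z ^ degree a) = (\<Sum>a\<in>(monics d :: 'a poly set). norm z ^ d)"
      by (rule sum.cong) (auto simp: monics_def)
    then show "(\<Sum>a\<in>(monics d :: 'a poly set). norm z ^ degree a) = r ^ d"
      by (simp add: card_monics r_def power_mult_distrib)
  qed
  also have "\<dots> \<le> r ^ N / (1 - r)"
    using r_bounds by (auto simp: sum_gp intro!: divide_right_mono)
  finally show ?thesis .
qed

lemma abs_summable: "A \<subseteq> {a. monic a} \<Longrightarrow> (\<lambda>a. norm (g a)) summable_on A"
  by (rule nonneg_bdd_above_summable_on)
     (auto intro!: bdd_aboveI[of _ "r ^ 0 / (1 - r)"] sum_norm_le)

lemma summable: "A \<subseteq> {a. monic a} \<Longrightarrow> g summable_on A"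
  using abs_summable by (rule abs_summable_summable)

lemma norm_infsum_le:
  assumes "A \<subseteq> {a. monic a \<and> N \<le> degree a}"
  shows "norm (infsum g A) \<le> r ^ N / (1 - r)"
proof -
  have A: "A \<subseteq> {a. monic a}" using assms by auto
  have "norm (infsum g A) \<le> infsum (\<lambda>a. norm (g a)) A"
    using abs_summable[OF A] by (rule norm_infsum_bound)
  also have "\<dots> \<le> r ^ N / (1 - r)"
    using assms by (intro infsum_le_finite_sums abs_summable[OF A] sum_norm_le) auto
  finally show ?thesis .
qed

lemma tail_tendsto_0: "(\<lambda>N. r ^ N / (1 - r)) \<longlonglongrightarrow> 0"
  using r_bounds by (intro tendsto_divide_zero LIMSEQ_realpow_zero) auto

lemma sums_L: "(\<lambda>d. sum F (monics d) * z ^ d) sums L"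
  unfolding sums_def
proof (rule Lim_transform[OF tendsto_const[of L]], rule Lim_null_comparison[OF _ tail_tendsto_0],
    intro always_eventually allI)
  fix N
  define A where "A = (\<Union>d<N. monics d :: 'a poly set)"
  define B where "B = {a :: 'a poly. monic a \<and> N \<le> degree a}"
  have "{a. monic a} = A \<union> B" "A \<inter> B = {}" by (auto simp: A_def B_def monics_def)
  then have "L = infsum g A + infsum g B"
    unfolding L_def by (metis infsum_Un_disjoint summable sup_ge1 sup_ge2)
  moreover have "infsum g A = sum g A" by (rule infsum_finite) (simp add: A_def)
  moreover have "sum g A = (\<Sum>d<N. sum g (monics d))"
    unfolding A_def by (rule sum.UNION_disjoint) (auto, auto simp: monics_def)
  moreover have "sum g (monics d) = sum F (monics d) * z ^ d" for d
    unfolding sum_distrib_right by (rule sum.cong) (auto simp: g_def monics_def)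
  ultimately have "L - (\<Sum>d<N. sum F (monics d) * z ^ d) = infsum g B" by simp
  moreover have "norm (infsum g B) \<le> r ^ N / (1 - r)" by (rule norm_infsum_le) (simp add: B_def)
  ultimately show "norm ((\<Sum>d<N. sum F (monics d) * z ^ d) - L) \<le> r ^ N / (1 - r)"
    by (metis norm_minus_commute)
qed

text \<open>Among the monic polynomials with no divisor in \<open>P\<close>, the multiples of a
  further irreducible p are p times the same set, because no element of \<open>P\<close> divides p.
  Removing them multiplies the sum by 1 - g p.\<close>

lemma sieve:
  assumes "finite P" "P \<subseteq> {p. monic p \<and> irreducible p}"
  shows "infsum g {a. monic a \<and> (\<forall>p\<in>P. \<not> p dvd a)} = L * (\<Prod>p\<in>P. 1 - g p)"
  using assms
proof (induction P rule: finite_induct)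
  case (insert p P)
  define A where "A = {a. monic a \<and> (\<forall>p\<in>P. \<not> p dvd a)}"
  have p: "monic p" "irreducible p" "p \<noteq> 0" using insert.prems monic_nonzero by auto
  have IH: "infsum g A = L * (\<Prod>p\<in>P. 1 - g p)" using insert by (simp add: A_def)
  have multiples: "{a \<in> A. p dvd a} = (\<lambda>a. p * a) ` A"
  proof (intro equalityI subsetI)
    fix a assume a: "a \<in> {a \<in> A. p dvd a}"
    then obtain k where k: "a = p * k" by (auto elim: dvdE)
    have "monic k" using a k p(1) by (simp add: A_def monic_def lead_coeff_mult)
    then have "k \<in> A" using a k by (auto simp: A_def)
    then show "a \<in> (\<lambda>a. p * a) ` A" using k by blast
  next
    fix a assume "a \<in> (\<lambda>a. p * a) ` A"
    then obtain k where k: "a = p * k" "k \<in> A" by blast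
    have "\<not> r dvd a" if r: "r \<in> P" for r
    proof
      assume "r dvd a"
      moreover have r': "monic r" "irreducible r" using r insert.prems by auto
      ultimately have "r dvd p \<or> r dvd k" using k irreducible_dvd_mult by blast
      then have "r dvd p" using k r by (auto simp: A_def)
      then have "r = p" using monic_irreducible_dvd_eq p r' by blast
      then show False using r insert.hyps by simp
    qed
    moreover have "monic a" using k p by (simp add: A_def monic_mult)
    ultimately show "a \<in> {a \<in> A. p dvd a}" using k by (simp add: A_def)
  qed
  have sub: "A \<subseteq> {a. monic a}" by (auto simp: A_def)
  have "A = {a \<in> A. \<not> p dvd a} \<union> {a \<in> A. p dvd a}" by auto
  then have "infsum g A = infsum g ({a \<in> A. \<not> p dvd a} \<union> {a \<in> A. p dvd a})" by simp
  also have "\<dots> = infsum g {a \<in> A. \<not> p dvd a} + infsum g {a \<in> A. p dvd a}"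
    by (rule infsum_Un_disjoint) (use sub in \<open>auto intro!: summable\<close>)
  also have "infsum g {a \<in> A. p dvd a} = infsum (\<lambda>a. g p * g a) A"
  proof -
    have "infsum g ((\<lambda>a. p * a) ` A) = infsum (g \<circ> (\<lambda>a. p * a)) A"
      by (rule infsum_reindex) (use p in \<open>auto simp: inj_on_def\<close>)
    also have "\<dots> = infsum (\<lambda>a. g p * g a) A"
      using sub p by (intro infsum_cong) (auto intro!: g_mult dest: monic_nonzero)
    finally show ?thesis by (simp add: multiples)
  qed
  also have "\<dots> = g p * infsum g A" by (rule infsum_cmult_right')
  finally have "infsum g A - g p * infsum g A = infsum g {a \<in> A. \<not> p dvd a}"
    unfolding diff_eq_eq .
  then have "infsum g {a \<in> A. \<not> p dvd a} = infsum g A * (1 - g p)"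
    by (metis mult.commute mult.right_neutral right_diff_distrib)
  moreover have "{a \<in> A. \<not> p dvd a} = {a. monic a \<and> (\<forall>p\<in>insert p P. \<not> p dvd a)}"
    by (auto simp: A_def)
  ultimately have "infsum g {a. monic a \<and> (\<forall>p\<in>insert p P. \<not> p dvd a)} =
      L * (\<Prod>p\<in>P. 1 - g p) * (1 - g p)"
    by (simp only: IH)
  then show ?case using insert.hyps by (simp add: mult_ac)
qed (simp add: L_def)

definition partial_product :: "nat \<Rightarrow> complex" where
  "partial_product N = (\<Prod>d\<le>N. \<Prod>p\<in>irreducible_monics d. 1 - F p * z ^ d)"

text \<open>Once all irreducibles of degree at most N are sieved out, only 1 and polynomials of
  degree above N remain, and the latter contribute at most the tail bound.\<close>

lemma L_mult_X_tendsto: "(\<lambda>N. L * partial_product N) \<longlonglongrightarrow> 1"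
proof (rule Lim_transform[OF tendsto_const[of 1]], rule Lim_null_comparison[OF _ tail_tendsto_0],
    intro always_eventually allI)
  fix N
  define P where "P = (\<Union>d\<le>N. irreducible_monics d :: 'a poly set)"
  define A where "A = {a. monic a \<and> (\<forall>p\<in>P. \<not> p dvd a)}"
  have "partial_product N = (\<Prod>d\<le>N. \<Prod>p\<in>irreducible_monics d. 1 - g p)"
    unfolding partial_product_def by (intro prod.cong refl) (auto simp: g_def irreducible_monics_def)
  also have "\<dots> = (\<Prod>p\<in>P. 1 - g p)"
    unfolding P_def by (rule prod.UNION_disjoint[symmetric]) (auto, auto simp: irreducible_monics_def)
  finally have "L * partial_product N = infsum g A"
    unfolding A_def by (subst sieve) (auto simp: P_def irreducible_monics_def[abs_def] simp del: finite_irreducible_monics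
        intro!: finite_irreducible_monics[unfolded irreducible_monics_def])
  moreover have A1: "A = {1} \<union> (A - {1})"
  proof -
    have "\<not> p dvd 1" if "p \<in> P" for p
      using that irreducible_not_unit by (auto simp: P_def irreducible_monics_def)
    then show ?thesis by (auto simp: A_def)
  qed
  moreover have "infsum g ({1} \<union> (A - {1})) = infsum g {1} + infsum g (A - {1})"
    by (rule infsum_Un_disjoint) (auto intro!: summable simp: A_def)
  moreover have "infsum g {1} = 1" by (simp add: g_def F_1)
  ultimately have "L * partial_product N - 1 = infsum g (A - {1})" by simp
  moreover have "A - {1} \<subseteq> {a. monic a \<and> N \<le> degree a}"
  proof safe
    fix a assume a: "a \<in> A" "a \<noteq> 1"
    then show m: "monic a" by (simp add: A_def)
    show "N \<le> degree a"
    proof (rule ccontr)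
      assume small: "\<not> N \<le> degree a"
      have a0: "a \<noteq> 0" using m by (rule monic_nonzero)
      then have "\<not> is_unit a" using a(2) m monic_degree_0 is_unit_iff_degree by blast
      then obtain p where p: "monic p" "irreducible p" "p dvd a" using monic_irreducible_factor a0 by blast
      then have "degree p \<le> N" using small dvd_imp_degree_le[OF p(3) a0] by simp
      then have "p \<in> P" using p by (auto simp: P_def irreducible_monics_def)
      then show False using a(1) p(3) by (simp add: A_def)
    qed
  qed
  ultimately show "norm (L * partial_product N - 1) \<le> r ^ N / (1 - r)" using norm_infsum_le by simp
qed

lemma has_prod_L: "(\<lambda>d. \<Prod>p\<in>irreducible_monics d. inverse (1 - F p * z ^ d)) has_prod L"
proof -
  \<comment> \<open>\<open>has_prod\<close> demands a nonzero limit, and L = 0 would contradict the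
    limit 1 in \<open>L_mult_X_tendsto\<close>.\<close>
  have L0: "L \<noteq> 0"
  proof
    assume "L = 0"
    then have "(\<lambda>N. 0 :: complex) \<longlonglongrightarrow> 1" using L_mult_X_tendsto by simp
    then show False using LIMSEQ_unique[OF tendsto_const] by fastforce
  qed
  have "(\<lambda>N. (L * partial_product N) / L) \<longlonglongrightarrow> 1 / L"
    using L0 by (intro tendsto_divide L_mult_X_tendsto tendsto_const)
  then have "partial_product \<longlonglongrightarrow> inverse L" using L0 by (simp add: inverse_eq_divide)
  then have "(\<lambda>N. inverse (partial_product N)) \<longlonglongrightarrow> inverse (inverse L)" using L0 by (intro tendsto_inverse) auto
  moreover have "inverse (partial_product N) = (\<Prod>d\<le>N. \<Prod>p\<in>irreducible_monics d. inverse (1 - F p * z ^ d))" for N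
    unfolding partial_product_def by (simp add: o_def flip: prod_inversef)
  ultimately show ?thesis using L0 by (simp add: has_prod_def raw_has_prod_def)
qed

end

text \<open>The difference is meromorphic and vanishes on a half-plane, hence off a sparse set. So
  both functions have the same limit or a common pole at every point, and nice meromorphy fixes the
  value in either case.\<close>

lemma nicely_meromorphic_unique:
  assumes f: "f nicely_meromorphic_on UNIV" and h: "h nicely_meromorphic_on UNIV"
    and eq: "\<And>s. Re s > b \<Longrightarrow> f s = h s"
  shows "f = h"
proof -
  have "(\<lambda>s. f s - h s) meromorphic_on UNIV"
    using f h by (intro meromorphic_intros) (auto simp: nicely_meromorphic_on_def)
  from meromorphic_imp_constant_or_avoid[OF this open_UNIV connected_UNIV, of 0]
  have "eventually (\<lambda>s. f s - h s = 0) (cosparse UNIV)"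
  proof (elim disjE)
    assume "\<forall>\<^sub>\<approx>s. f s - h s \<noteq> 0"
    then have "\<forall>\<^sub>F s in at (of_real (b + 1)). f s - h s \<noteq> 0"
      by (auto simp: eventually_cosparse_open_eq)
    moreover have "\<forall>\<^sub>F s in at (of_real (b + 1)). s \<in> {s. Re s > b}"
      by (rule eventually_at_in_open') (auto simp: open_halfspace_Re_gt)
    ultimately have "\<forall>\<^sub>F s in at (of_real (b + 1) :: complex). False"
      by eventually_elim (use eq in auto)
    then show ?thesis by simp
  qed auto
  then have near: "\<forall>\<^sub>F s in at z. f s = h s" for z
    by (auto simp: eventually_cosparse_open_eq)
  show ?thesis
  proof
    fix z
    have "is_pole f z \<longleftrightarrow> is_pole h z" using near by (rule is_pole_cong) simp
    moreover have "f z = h z" if "f \<midarrow>z\<rightarrow> f z" "h \<midarrow>z\<rightarrow> h z"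
    proof -
      have "f \<midarrow>z\<rightarrow> h z" using that(2) tendsto_cong[OF near] by blast
      then show ?thesis using that(1) LIM_unique by blast
    qed
    moreover have "is_pole f z \<and> f z = 0 \<or> f \<midarrow>z\<rightarrow> f z" "is_pole h z \<and> h z = 0 \<or> h \<midarrow>z\<rightarrow> h z"
      using f h by (auto simp: nicely_meromorphic_on_def)
    moreover have "\<not> is_pole f z" if "f \<midarrow>z\<rightarrow> f z" for f :: "complex \<Rightarrow> complex"
      using that not_tendsto_and_filterlim_at_infinity[of "at z" f] by (auto simp: is_pole_def)
    ultimately show "f z = h z" by metis
  qed
qed

section \<open>The L-function and its derivative\<close>

context G_character
begin

definition qpow :: "complex \<Rightarrow> complex" where
  "qpow s = exp (- s * of_real (ln (real CARD('a))))"

lemma poly_abs_powr: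
  assumes "p \<noteq> 0"
  shows "of_real (poly_abs (p :: 'a poly)) powr (- s) = qpow s ^ degree p"
proof -
  have q: "real CARD('a) > 0" using card_field_gt_1[where 'a = 'a] by simp
  have "of_real (poly_abs p) powr (- s) = exp (- s * of_real (degree p * ln (real CARD('a))))"
    using q assms by (simp add: poly_abs_eq powr_def Ln_of_real ln_realpow flip: of_real_power)
  also have "\<dots> = qpow s ^ degree p"
    by (simp add: qpow_def exp_of_nat_mult[symmetric] mult_ac)
  finally show ?thesis .
qed

lemma norm_qpow_small:
  assumes "Re s > 1"
  shows "real CARD('a) * norm (om * qpow s) < 1"
proof -
  define t where "t = ln (real CARD('a))"
  have t: "t > 0" unfolding t_def by (rule ln_card_field_pos)
  have "real CARD('a) = exp t" using card_field_gt_1[where 'a = 'a] by (simp add: t_def)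
  moreover have "norm (om * qpow s) = exp (- (Re s * t))"
    by (simp add: norm_mult norm_om qpow_def t_def[symmetric] norm_exp_eq_Re)
  ultimately have "real CARD('a) * norm (om * qpow s) = exp (t - Re s * t)"
    by (simp add: mult_exp_exp)
  also have "t - Re s * t < 0" using t assms by simp
  then have "exp (t - Re s * t) < 1" by simp
  finally show ?thesis .
qed

lemma euler_product_sums:
  assumes "Re s > 1"
  shows "(\<lambda>d. sum F (monics d) * (om * qpow s) ^ d) sums euler_product n l chi s"
proof -
  interpret bounded_multiplicative F "om * qpow s"
    using F_mult F_1 norm_F_le norm_qpow_small[OF assms] by unfold_locales
  have "(\<Prod>p | monic p \<and> irreducible p \<and> degree p = d \<and> \<not> p dvd cond.
        inverse (1 - prim_char n l chi p (degree p) * of_real (poly_abs p) powr (- s))) =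
      (\<Prod>p\<in>irreducible_monics d. inverse (1 - F p * (om * qpow s) ^ d))" for d
  \<comment> \<open>The primes dividing the conductor are put back: \<open>F\<close> vanishes on
    them, so their factors are 1.\<close>
  proof (rule prod.mono_neutral_cong_left)
    show "\<forall>p\<in>irreducible_monics d - {p. monic p \<and> irreducible p \<and> degree p = d \<and> \<not> p dvd cond}.
        inverse (1 - F p * (om * qpow s) ^ d) = 1"
    proof
      fix p assume "p \<in> irreducible_monics d - {p. monic p \<and> irreducible p \<and> degree p = d \<and> \<not> p dvd cond}"
      then have "irreducible p" "p dvd cond" by (auto simp: irreducible_monics_def)
      then have "\<not> coprime p cond"
        using irreducible_not_unit[of p] coprime_common_divisor[of p cond p] by auto
      then show "inverse (1 - F p * (om * qpow s) ^ d) = 1" by (simp add: F_not_coprime)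
    qed
    fix p assume "p \<in> {p. monic p \<and> irreducible p \<and> degree p = d \<and> \<not> p dvd cond}"
    then have p: "monic p" "irreducible p" "degree p = d" "\<not> p dvd cond" by auto
    then have "coprime p cond" by (intro irreducible_coprime_or_dvd)
    then show "inverse (1 - prim_char n l chi p (degree p) * of_real (poly_abs p) powr (- s)) =
        inverse (1 - F p * (om * qpow s) ^ d)"
      using p monic_nonzero[OF p(1)]
      by (simp add: prim_char_eq poly_abs_powr power_mult_distrib mult.assoc)
  next
    show "{p. monic p \<and> irreducible p \<and> degree p = d \<and> \<not> p dvd cond} \<subseteq> irreducible_monics d"
      by (auto simp: irreducible_monics_def)
  qed simp
  then have "euler_product n l chi s = (\<Prod>d. \<Prod>p\<in>irreducible_monics d. inverse (1 - F p * (om * qpow s) ^ d))"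
    unfolding euler_product_def cond_def[symmetric] by simp
  also have "\<dots> = L" by (rule has_prod_unique[OF has_prod_L, symmetric])
  finally show ?thesis using sums_L by simp
qed

text \<open>At a pole of the first branch the value is \<open>inverse 0 = 0\<close>, the dummy value
  that a nicely meromorphic function takes there.\<close>

definition L_explicit :: "complex \<Rightarrow> complex" where
  "L_explicit s =
     (if degree cond = 0 then inverse (1 - of_nat CARD('a) * (om * qpow s))
      else \<Sum>d<degree cond. sum F (monics d) * (om * qpow s) ^ d)"

lemma L_explicit_eq_euler_product:
  assumes "Re s > 1"
  shows "L_explicit s = euler_product n l chi s"
proof (cases "degree cond = 0")
  case True
  define w where "w = of_nat CARD('a) * (om * qpow s)"
  have "norm w < 1" using norm_qpow_small[OF assms] by (simp add: w_def norm_mult)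
  then have "(\<lambda>d. w ^ d) sums (1 / (1 - w))" by (rule geometric_sums)
  moreover have "sum F (monics d) * (om * qpow s) ^ d = w ^ d" for d
    using True by (simp add: sum_F_monics w_def power_mult_distrib)
  ultimately have "euler_product n l chi s = 1 / (1 - w)"
    using euler_product_sums[OF assms] sums_unique2 by simp
  then show ?thesis using True by (simp add: L_explicit_def w_def inverse_eq_divide)
next
  case False
  have "(\<lambda>d. sum F (monics d) * (om * qpow s) ^ d) sums
      (\<Sum>d<degree cond. sum F (monics d) * (om * qpow s) ^ d)"
    by (rule sums_finite) (use False sum_F_monics(1) in auto)
  then show ?thesis
    using False euler_product_sums[OF assms] sums_unique2 by (simp add: L_explicit_def) blast
qed

lemma analytic_qpow [analytic_intros]: "qpow analytic_on A"
  unfolding qpow_def by (intro analytic_intros)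

lemma nicely_meromorphic_L_explicit: "L_explicit nicely_meromorphic_on UNIV"
proof (cases "degree cond = 0")
  case True
  then have "L_explicit = (\<lambda>s. inverse (1 - of_nat CARD('a) * (om * qpow s)))"
    by (simp add: L_explicit_def fun_eq_iff)
  then show ?thesis
    by (simp only:) (intro nicely_meromorphic_on_inverse analytic_on_imp_nicely_meromorphic_on analytic_intros)
next
  case False
  then have "L_explicit = (\<lambda>s. \<Sum>d<degree cond. sum F (monics d) * (om * qpow s) ^ d)"
    by (simp add: L_explicit_def fun_eq_iff)
  then show ?thesis
    by (simp only:) (intro analytic_on_imp_nicely_meromorphic_on analytic_intros)
qed

lemma L_fun_eq: "L_fun n l chi = L_explicit"
  unfolding L_fun_def
proof (rule the_equality)
  fix f assume "f nicely_meromorphic_on UNIV \<and> (\<forall>s. Re s > 1 \<longrightarrow> f s = euler_product n l chi s)"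
  then show "f = L_explicit"
    using nicely_meromorphic_L_explicit L_explicit_eq_euler_product
    by (intro nicely_meromorphic_unique[of f L_explicit 1]) auto
qed (use nicely_meromorphic_L_explicit L_explicit_eq_euler_product in auto)

section \<open>Evaluation of the gamma sums and of the derivative at 0\<close>

lemma om_power_mod: "om ^ (m mod l) = om ^ m"
proof -
  have "om ^ m = om ^ (l * (m div l) + m mod l)" by simp
  then show ?thesis by (simp only: power_add power_mult om_power_l power_one mult_1)
qed

text \<open>Exactly one i below \<open>l\<close> solves the congruence, and a power of
  \<open>om\<close> depends only on its exponent modulo \<open>l\<close>.\<close>

lemma sum_shifted_residues:
  "(\<Sum>i<l. om ^ (i + m) * (if (i + m) mod l = k mod l then 1 else 0)) = om ^ k"
proof -
  \<comment> \<open>A representative of k - m modulo \<open>l\<close>; the multiple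
    \<open>l * m\<close> keeps the subtraction within the natural numbers.\<close>
  define i0 where "i0 = (k + (l * m - m)) mod l"
  have "m \<le> l * m" using l_pos by simp
  then have "(k + (l * m - m)) + m = k + l * m" by (simp only: add.assoc le_add_diff_inverse2)
  then have i0: "(i0 + m) mod l = k mod l"
    unfolding i0_def by (metis mod_add_left_eq mod_mult_self2)
  have "i0 < l" using l_pos by (simp add: i0_def)
  have unique: "i = i0" if "i < l" "(i + m) mod l = k mod l" for i
  proof -
    have "[i + m = i0 + m] (mod l)" using that i0 by (simp add: cong_def)
    then have "[i = i0] (mod l)" by (simp only: cong_add_rcancel_nat)
    then show ?thesis using that(1) \<open>i0 < l\<close> by (simp add: cong_def)
  qed
  have "(\<Sum>i<l. om ^ (i + m) * (if (i + m) mod l = k mod l then 1 else 0)) =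
      (\<Sum>i<l. if i = i0 then om ^ (i0 + m) else 0)"
  proof (rule sum.cong[OF refl])
    fix i assume "i \<in> {..<l}"
    then have "(i + m) mod l = k mod l \<longleftrightarrow> i = i0" using unique[of i] i0 by blast
    then show "om ^ (i + m) * (if (i + m) mod l = k mod l then 1 else 0) =
        (if i = i0 then om ^ (i0 + m) else 0)"
      by simp
  qed
  also have "\<dots> = om ^ (i0 + m)" using \<open>i0 < l\<close> by simp
  also have "\<dots> = om ^ k" using i0 om_power_mod by metis
  finally show ?thesis .
qed

text \<open>
  The digit derivatives, represented by \<open>w\<close>, do not contribute because \<open>F\<close> sums to zero.
\<close>
lemma gamma_sum_nontrivial:
  fixes D :: nat and w :: "nat \<Rightarrow> complex"
  assumes D: "degree cond = D" "D > 0"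
  defines "P \<equiv> \<lambda>a i. if monic a \<and> (i + D) mod l = degree a mod l then 1 else 0 :: complex"
  shows "(\<Sum>a\<in>polys_below D. \<Sum>i<l. F a * om ^ (i + D) * (P a i * of_nat (D - degree a) - w i)) =
    (\<Sum>d<D. sum F (monics d) * om ^ d * of_nat (D - d))"
proof -
  define W where "W = (\<Sum>i<l. om ^ (i + D) * w i)"
  define h where "h a = (if monic a then F a * om ^ degree a * of_nat (D - degree a) else 0)" for a
  \<comment> \<open>For monic \<open>a\<close> a single \<open>i\<close> survives in the sum with
    \<open>P\<close>, and its weight om^(i + D) equals om^(deg a), the weight of \<open>a\<close> in
    the L-series.\<close>
  have inner: "(\<Sum>i<l. F a * om ^ (i + D) * (P a i * of_nat (D - degree a) - w i)) = h a - F a * W" for a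
  proof -
    have "(\<Sum>i<l. F a * om ^ (i + D) * (P a i * of_nat (D - degree a) - w i)) =
        F a * of_nat (D - degree a) * (\<Sum>i<l. om ^ (i + D) * P a i) - F a * W"
      by (simp add: W_def sum_distrib_left sum_subtractf[symmetric] algebra_simps)
    also have "(\<Sum>i<l. om ^ (i + D) * P a i) = (if monic a then om ^ degree a else 0)"
      using sum_shifted_residues[of D "degree a"] by (simp add: P_def)
    finally show ?thesis by (simp add: h_def)
  qed
  have "(\<Sum>a\<in>polys_below D. h a) = (\<Sum>a\<in>(\<Union>d<D. monics d). h a)"
    by (rule sum.mono_neutral_right)
       (use D(2) finite_card_polys_below in \<open>auto simp: polys_below_def monics_def h_def\<close>)
  also have "\<dots> = (\<Sum>d<D. sum h (monics d))"
    by (rule sum.UNION_disjoint) (auto, auto simp: monics_def)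
  also have "\<dots> = (\<Sum>d<D. sum F (monics d) * om ^ d * of_nat (D - d))"
    unfolding sum_distrib_right by (intro sum.cong refl) (auto simp: h_def monics_def)
  finally have h: "(\<Sum>a\<in>polys_below D. h a) = (\<Sum>d<D. sum F (monics d) * om ^ d * of_nat (D - d))" .
  have "(\<Sum>a\<in>polys_below D. F a * W) = 0"
    using sum_F_eq_0 D by (simp flip: sum_distrib_right)
  then show ?thesis by (simp add: inner sum_subtractf h)
qed

lemma deriv_L_nontrivial:
  assumes "degree cond > 0"
  shows "deriv L_explicit 0 =
    - of_real (ln (real CARD('a))) * (\<Sum>d<degree cond. sum F (monics d) * om ^ d * of_nat d)"
proof -
  define t :: complex where "t = of_real (ln (real CARD('a)))"
  have "L_explicit = (\<lambda>s. \<Sum>d<degree cond. sum F (monics d) * om ^ d * exp (of_nat d * (- s * t)))"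
  proof
    fix s
    have "L_explicit s = (\<Sum>d<degree cond. sum F (monics d) * (om * exp (- s * t)) ^ d)"
      using assms by (simp add: L_explicit_def qpow_def t_def)
    also have "\<dots> = (\<Sum>d<degree cond. sum F (monics d) * om ^ d * exp (of_nat d * (- s * t)))"
      unfolding exp_of_nat_mult power_mult_distrib mult.assoc ..
    finally show "L_explicit s = (\<Sum>d<degree cond. sum F (monics d) * om ^ d * exp (of_nat d * (- s * t)))" .
  qed
  moreover have "((\<lambda>s. \<Sum>d<degree cond. sum F (monics d) * om ^ d * exp (of_nat d * (- s * t)))
      has_field_derivative (\<Sum>d<degree cond. sum F (monics d) * om ^ d * (of_nat d * (- t)))) (at 0)"
    by (auto intro!: derivative_eq_intros sum.cong)
  ultimately show ?thesis
    by (simp add: DERIV_imp_deriv t_def sum_distrib_left mult_ac)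
qed

text \<open>
  With \<open>z = q om\<close>, both sides are formally the sum of the \<open>n z\<^sup>n\<close>; grouping the terms by
  \<open>n mod l\<close> gives the left-hand side, because \<open>z\<^sup>l = q\<^sup>l\<close>.
\<close>
lemma gamma_sum_trivial:
  "(\<Sum>i<l. om ^ i * of_real (digit_deriv_value CARD('a) l i)) =
    of_nat CARD('a) * om / (1 - of_nat CARD('a) * om)\<^sup>2"
proof -
  define z where "z = of_nat CARD('a) * om"
  define Q :: complex where "Q = of_nat CARD('a) ^ l"
  have zl: "z ^ l = Q" by (simp add: z_def Q_def power_mult_distrib om_power_l)
  have q1: "1 < CARD('a)" using card_field_gt_1[where 'a = 'a] by simp
  have "1 < CARD('a) ^ l" using q1 l_pos by (intro one_less_power) auto
  then have "Q \<noteq> 1" unfolding Q_def by (metis less_irrefl of_nat_1 of_nat_eq_iff of_nat_power)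
  then have Q1: "1 - Q \<noteq> 0" by simp
  have z1: "1 - z \<noteq> 0" using zl \<open>Q \<noteq> 1\<close> by auto
  \<comment> \<open>The closed form of the sum of i z^i, with the denominator cleared so that the
    induction uses ring identities only; at m = l the power z^m becomes \<open>Q\<close>.\<close>
  have arith: "(\<Sum>i<m. of_nat i * z ^ i) * (1 - z)\<^sup>2 = z - of_nat m * z ^ m * (1 - z) - z ^ m * z" for m
  proof (induction m)
    case (Suc m)
    have "(\<Sum>i<Suc m. of_nat i * z ^ i) * (1 - z)\<^sup>2 =
        (\<Sum>i<m. of_nat i * z ^ i) * (1 - z)\<^sup>2 + of_nat m * z ^ m * (1 - z)\<^sup>2"
      by (simp add: distrib_right)
    also have "\<dots> = z - of_nat (Suc m) * z ^ Suc m * (1 - z) - z ^ Suc m * z"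
      unfolding Suc by (simp add: algebra_simps power2_eq_square)
    finally show ?case .
  qed simp
  have geom: "(\<Sum>i<m. z ^ i) * (1 - z) = 1 - z ^ m" for m
    by (simp add: one_diff_power_eq mult.commute)
  have "om ^ i * of_real (digit_deriv_value CARD('a) l i) =
      of_nat i * z ^ i / (1 - Q) + of_nat l * Q * z ^ i / (1 - Q)\<^sup>2" for i
    by (simp add: digit_deriv_value_def z_def Q_def power_mult_distrib power_add algebra_simps)
  then have "(\<Sum>i<l. om ^ i * of_real (digit_deriv_value CARD('a) l i)) =
      (\<Sum>i<l. of_nat i * z ^ i) / (1 - Q) + of_nat l * Q * (\<Sum>i<l. z ^ i) / (1 - Q)\<^sup>2"
    by (simp add: sum.distrib sum_divide_distrib sum_distrib_left)
  also have "(\<Sum>i<l. of_nat i * z ^ i) = (z * (1 - Q) - of_nat l * Q * (1 - z)) / (1 - z)\<^sup>2"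
    using arith[of l] z1 zl by (simp add: eq_divide_eq algebra_simps)
  also have "(\<Sum>i<l. z ^ i) = (1 - Q) / (1 - z)"
    using geom[of l] z1 zl by (simp add: eq_divide_eq)
  also have "(z * (1 - Q) - of_nat l * Q * (1 - z)) / (1 - z)\<^sup>2 / (1 - Q) +
      of_nat l * Q * ((1 - Q) / (1 - z)) / (1 - Q)\<^sup>2 = z / (1 - z)\<^sup>2"
  proof -
    define R S where "R = 1 - Q" and "S = 1 - z"
    have "R \<noteq> 0" "S \<noteq> 0" using Q1 z1 by (simp_all add: R_def S_def)
    then show ?thesis unfolding R_def[symmetric] S_def[symmetric]
      by (simp add: field_simps power2_eq_square)
  qed
  finally show ?thesis by (simp add: z_def)
qed

text \<open>The point 0 is not a pole: z = q om satisfies z^l = q^l, so z is not 1.\<close>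

lemma deriv_L_trivial:
  assumes "degree cond = 0"
  shows "deriv L_explicit 0 = - of_real (ln (real CARD('a))) *
    (of_nat CARD('a) * om / (1 - of_nat CARD('a) * om)\<^sup>2)"
proof -
  define t :: complex where "t = of_real (ln (real CARD('a)))"
  define z where "z = of_nat CARD('a) * om"
  have "1 < CARD('a) ^ l" using card_field_gt_1[where 'a = 'a] l_pos by (intro one_less_power) auto
  then have "(of_nat CARD('a) :: complex) ^ l \<noteq> 1"
    by (metis less_irrefl of_nat_1 of_nat_eq_iff of_nat_power)
  then have "z ^ l \<noteq> 1" by (simp add: z_def power_mult_distrib om_power_l)
  then have z1: "z \<noteq> 1" by auto
  have "L_explicit = (\<lambda>s. inverse (1 - z * exp (- s * t)))"
    using assms by (simp add: L_explicit_def fun_eq_iff qpow_def t_def z_def mult.assoc)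
  moreover have "((\<lambda>s. inverse (1 - z * exp (- s * t))) has_field_derivative
      - (t * (z / (1 - z)\<^sup>2))) (at 0)"
    using z1 by (auto intro!: derivative_eq_intros simp: power2_eq_square field_simps)
  ultimately show ?thesis by (simp add: DERIV_imp_deriv t_def z_def)
qed

lemma deriv_L_formula:
  "deriv (L_fun n l chi) 0 =
     - L_fun n l chi 0 * of_real (ln (poly_abs cond)) +
     (\<Sum>a | (a = 0 \<or> degree a < degree cond) \<and> coprime a cond.
        \<Sum>i<l. prim_char n l chi a (i + degree cond) *
          of_real (ln (cinf_abs (Gamma_star l i (at_theta a / at_theta cond)))))"
proof (cases "degree cond = 0")
  case True
  have c: "cond = 1" by (rule F_cond_1(1)[OF True])
  have "{a. (a = 0 \<or> degree a < degree cond) \<and> coprime a cond} = {0}" by (auto simp: c)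
  moreover have "ln (cinf_abs (Gamma_star l i (0 :: 'a fls))) =
      - digit_deriv_value CARD('a) l i * ln (real CARD('a))" if "i < l" for i
    using ln_cinf_abs_Gamma_star[of 0 i l] that by simp
  ultimately have "(\<Sum>a | (a = 0 \<or> degree a < degree cond) \<and> coprime a cond.
        \<Sum>i<l. prim_char n l chi a (i + degree cond) *
          of_real (ln (cinf_abs (Gamma_star l i (at_theta a / at_theta cond))))) =
      (\<Sum>i<l. om ^ i * of_real (- digit_deriv_value CARD('a) l i * ln (real CARD('a))))"
    using True by (simp add: prim_char_eq F_cond_1(2) c)
  also have "\<dots> = - of_real (ln (real CARD('a))) * (\<Sum>i<l. om ^ i * of_real (digit_deriv_value CARD('a) l i))"
    by (simp add: sum_distrib_left sum_negf mult_ac)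
  also have "\<dots> = deriv (L_fun n l chi) 0"
    unfolding gamma_sum_trivial L_fun_eq deriv_L_trivial[OF True] ..
  finally show ?thesis by (simp add: c ln_poly_abs)
next
  case False
  define D where "D = degree cond"
  have D: "degree cond = D" "D > 0" using False by (simp_all add: D_def)
  define t where "t = ln (real CARD('a))"
  define w where "w i = (of_real (digit_deriv_value CARD('a) l i) :: complex)" for i
  define P where "P a i = (if monic a \<and> (i + D) mod l = degree a mod l then 1 else 0 :: complex)"
    for a :: "'a poly" and i
  have ln_Gamma: "of_real (ln (cinf_abs (Gamma_star l i (at_theta a / at_theta cond)))) =
      (P a i * of_nat (D - degree a) - w i) * of_real t"
    if a: "a \<noteq> 0" "degree a < D" and i: "i < l" for a i
  proof -
    have sub: "fls_subdegree (at_theta a / at_theta cond) = int (D - degree a)"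
      using a D by (subst fls_divide_subdegree) (simp_all add: fls_subdegree_at_theta)
    have "ln (cinf_abs (Gamma_star l i (at_theta a / at_theta cond))) =
        (real (pairing l i (at_theta a / at_theta cond)) * of_int (int (D - degree a))
          - digit_deriv_value CARD('a) l i) * t"
      using ln_cinf_abs_Gamma_star[of "at_theta a / at_theta cond" i l] a i by (simp add: sub t_def)
    then show ?thesis
      using pairing_at_theta[OF monic_cond a(1), of l i] a D by (simp add: P_def w_def)
  qed
  have "(\<Sum>a | (a = 0 \<or> degree a < degree cond) \<and> coprime a cond.
        \<Sum>i<l. prim_char n l chi a (i + degree cond) *
          of_real (ln (cinf_abs (Gamma_star l i (at_theta a / at_theta cond))))) =
      (\<Sum>a\<in>polys_below D. \<Sum>i<l. F a * om ^ (i + D) * ((P a i * of_nat (D - degree a) - w i) * of_real t))"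
  proof (rule sum.mono_neutral_cong_left)
    fix a assume "a \<in> {a. (a = 0 \<or> degree a < degree cond) \<and> coprime a cond}"
    then have a: "a = 0 \<or> degree a < degree cond" "coprime a cond" by auto
    \<comment> \<open>The residue 0 is not prime to a conductor of positive degree, so
      \<open>ln_Gamma\<close> applies throughout the sum.\<close>
    have "a \<noteq> 0" using a(2) D by (auto simp: is_unit_iff_degree)
    then show "(\<Sum>i<l. prim_char n l chi a (i + degree cond) *
          of_real (ln (cinf_abs (Gamma_star l i (at_theta a / at_theta cond))))) =
        (\<Sum>i<l. F a * om ^ (i + D) * ((P a i * of_nat (D - degree a) - w i) * of_real t))"
      using a D by (intro sum.cong refl) (simp add: prim_char_eq ln_Gamma)
  next
    show "finite (polys_below D :: 'a poly set)"
      using finite_card_polys_below[of D, where 'a = 'a] by simp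
    show "{a. (a = 0 \<or> degree a < degree cond) \<and> coprime a cond} \<subseteq> polys_below D"
      by (auto simp: polys_below_def D)
    show "\<forall>a\<in>polys_below D - {a. (a = 0 \<or> degree a < degree cond) \<and> coprime a cond}.
        (\<Sum>i<l. F a * om ^ (i + D) * ((P a i * of_nat (D - degree a) - w i) * of_real t)) = 0"
    proof
      fix a assume "a \<in> polys_below D - {a. (a = 0 \<or> degree a < degree cond) \<and> coprime a cond}"
      then have "\<not> coprime a cond" by (auto simp: polys_below_def D)
      then show "(\<Sum>i<l. F a * om ^ (i + D) * ((P a i * of_nat (D - degree a) - w i) * of_real t)) = 0"
        by (simp add: F_not_coprime)
    qed
  qed
  also have "\<dots> = of_real t * (\<Sum>a\<in>polys_below D. \<Sum>i<l. F a * om ^ (i + D) * (P a i * of_nat (D - degree a) - w i))"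
    by (simp add: sum_distrib_left mult_ac)
  also have "\<dots> = of_real t * (\<Sum>d<D. sum F (monics d) * om ^ d * of_nat (D - d))"
    unfolding P_def by (subst gamma_sum_nontrivial[OF D]) simp
  also have "\<dots> = deriv (L_fun n l chi) 0 + L_fun n l chi 0 * of_real (ln (poly_abs cond))"
  proof -
    have deriv: "deriv (L_fun n l chi) 0 = - of_real t * (\<Sum>d<D. sum F (monics d) * om ^ d * of_nat d)"
      using deriv_L_nontrivial D by (simp add: L_fun_eq t_def)
    have L0: "L_fun n l chi 0 = (\<Sum>d<D. sum F (monics d) * om ^ d)"
      using D by (simp add: L_fun_eq L_explicit_def qpow_def)
    have split: "(\<Sum>d<D. sum F (monics d) * om ^ d * of_nat (D - d)) =
        (\<Sum>d<D. sum F (monics d) * om ^ d) * of_nat D - (\<Sum>d<D. sum F (monics d) * om ^ d * of_nat d)"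
      unfolding sum_distrib_right sum_subtractf[symmetric]
      by (rule sum.cong) (simp_all add: of_nat_diff right_diff_distrib)
    have ln_cond: "ln (poly_abs cond) = D * t" by (simp add: ln_poly_abs D t_def)
    show ?thesis unfolding deriv L0 split ln_cond by (simp add: algebra_simps)
  qed
  finally show ?thesis by simp
qed

end

theorem theorem6p4p5:
  fixes n :: "'a::{finite,field} poly" and l :: nat and chi :: "'a poly \<times> int \<Rightarrow> complex"
  assumes "monic n" and "l \<ge> 1" and "chi \<in> G_characters n l"
  defines "c \<equiv> conductor n chi"
  shows "deriv (L_fun n l chi) 0 =
           - L_fun n l chi 0 * of_real (ln (poly_abs c)) +
           (\<Sum>a | (a = 0 \<or> degree a < degree c) \<and> coprime a c.
              \<Sum>i<l. prim_char n l chi a (i + degree c) *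
                of_real (ln (cinf_abs (Gamma_star l i (at_theta a / at_theta c)))))"
proof -
  interpret G_character n l chi using assms by unfold_locales
  show ?thesis using deriv_L_formula unfolding cond_def c_def .
qed

end
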